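(* Let $p,q$ be real parameters with $q\neq0$. The planar quadratic differential system in the variables $(z,y)$ $$\dot z=zy+1,\qquad \dot y=3y^2-\tfrac{8}{13}qzy-\tfrac{24}{169}q^2z^2+q$$ has the following algebraic curve $g=0$, of degree eighteen and genus two, as an invariant algebraic curve with cofactor $K=18y$: $$\begin{aligned} g={}&\tfrac{16777216}{23298085122481}z^{18}q^{12}-\tfrac{50331648}{1792160394037}q^{11}z^{16}+\tfrac{12582912}{137858491849}yz^{15}q^{10}+\tfrac{60555264}{137858491849}z^{14}q^{10}\\ &-\tfrac{26738688}{10604499373}yq^9z^{13}+\Big(-\tfrac{2818048}{815730721}q^9+\tfrac{3342336}{815730721}y^2q^8\Big)z^{12}+\tfrac{20840448}{815730721}yz^{11}q^8\\ &+\Big(\tfrac{11452416}{815730721}q^8-\tfrac{1728}{4826809}q^6p-\tfrac{4325376}{62748517}y^2q^7\Big)z^{10}+\Big(-\tfrac{540672}{4826809}yq^7+\tfrac{360448}{4826809}y^3q^6\Big)z^9\\ &+\Big(\tfrac{2592}{371293}q^5p+\tfrac{1695744}{4826809}y^2q^6-\tfrac{1744896}{62748517}q^7+\tfrac{288}{28561}y^2q^4p\Big)z^8\\ &+\Big(-\tfrac{196608}{371293}y^3q^5+\tfrac{964608}{4826809}yq^6-\tfrac{720}{28561}yq^4p-\tfrac{64}{2197}y^3q^3p\Big)z^7\\ &+\Big(\tfrac{4}{169}y^4pq^2-\tfrac{196608}{371293}y^2q^5+\tfrac{132544}{4826809}q^6-\tfrac{90}{2197}q^4p-\tfrac{264}{2197}y^2q^3p+\tfrac{12288}{28561}y^4q^4\Big)z^6\\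 &+\Big(\tfrac{474}{2197}yq^3p+\tfrac{18432}{28561}y^3q^4-\tfrac{59136}{371293}yq^5+\tfrac{136}{169}y^3pq^2\Big)z^5\\ &+\Big(-\tfrac{5712}{371293}q^5+\tfrac{241}{4394}pq^3+\tfrac{10896}{28561}y^2q^4-\tfrac{69}{338}y^2pq^2-\tfrac{20}{13}y^4qp\Big)z^4\\ &+\Big(-\tfrac12y^3pq-\tfrac{608}{2197}y^3q^3+\tfrac{1104}{28561}yq^4+y^5p-\tfrac{11}{52}ypq^2\Big)z^3\\ &+\Big(\tfrac{177}{2197}q^4+\tfrac{3}{26}y^2pq+\tfrac{204}{169}y^4q^2+\tfrac{1224}{2197}y^2q^3+\tfrac34y^4p-\tfrac{23}{832}pq^2\Big)z^2\\ &+\Big(\tfrac{3}{16}y^3p+\tfrac{23}{416}ypq-\tfrac{354}{2197}yq^3-\tfrac{180}{169}y^3q^2-\tfrac{24}{13}y^5q\Big)z\\ &+y^6+\tfrac{15}{2197}q^3+\tfrac{9}{13}y^4q+\tfrac{1}{208}pq+\tfrac{1}{64}y^2p+\tfrac{24}{169}y^2q^2. \end{aligned}$$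
   Context: For a polynomial differential system $\dot z=P(z,y)$, $\dot y=Q(z,y)$, an algebraic curve $g(z,y)=0$ (with $g$ a polynomial) is invariant with cofactor $K$, where $K$ is a polynomial, if $P\,\partial g/\partial z+Q\,\partial g/\partial y=K g$ identically. The degree of the curve is the total degree of $g$ in $(z,y)$; the genus of the curve is the geometric genus of the complex projective curve defined by $g$. The system is quadratic if $\max(\deg P,\deg Q)=2$.
   Formalization: Genus two (with irreducibility over C) is claimed only when 169p ≠ 192q² and 169p ≠ −240q²; at these two values g is a cube of a sextic of genus 0, resp. a square of a degree-9 polynomial, so the genus claim fails. Invariance and degree are proved for all p. *)

theory Defs
  imports
    "HOL-Computational_Algebra.Computational_Algebra"
    "HOL-Computational_Algebra.Formal_Laurent_Series"
    "HOL-Library.Function_Algebras"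
begin

section \<open>Polynomials in two variables\<close>

text \<open>
  A polynomial in \<open>(z, y)\<close> is a polynomial in \<open>y\<close> whose coefficients are polynomials in \<open>z\<close>.
\<close>

type_synonym 'a bipoly = "'a poly poly"

definition bconst :: "'a::comm_semiring_1 \<Rightarrow> 'a bipoly" where
  "bconst c = [:[:c:]:]"

definition Z :: "'a::comm_semiring_1 bipoly" where
  "Z = [:[:0, 1:]:]"

definition Y :: "'a::comm_semiring_1 bipoly" where
  "Y = [:0, 1:]"

definition partial_z :: "'a::idom bipoly \<Rightarrow> 'a bipoly" where
  "partial_z f = map_poly pderiv f"

definition partial_y :: "'a::idom bipoly \<Rightarrow> 'a bipoly" where
  "partial_y f = pderiv f"

text \<open>The zero polynomial has total degree \<open>0\<close>.\<close>

definition total_degree :: "'a::zero bipoly \<Rightarrow> nat" where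
  "total_degree f = Max (insert 0 {i + j |i j. coeff (coeff f j) i \<noteq> 0})"

definition complexify :: "real bipoly \<Rightarrow> complex bipoly" where
  "complexify f = map_poly (map_poly complex_of_real) f"


section \<open>Polynomial differential systems and invariant algebraic curves\<close>

text \<open>
  The system \<open>z' = P(z, y)\<close>, \<open>y' = Q(z, y)\<close> is given by the two polynomials \<open>P\<close> and \<open>Q\<close>.
\<close>

definition quadratic_system :: "'a::zero bipoly \<Rightarrow> 'a bipoly \<Rightarrow> bool" where
  "quadratic_system P Q \<longleftrightarrow> max (total_degree P) (total_degree Q) = 2"

definition invariant_curve ::
    "'a::idom bipoly \<Rightarrow> 'a bipoly \<Rightarrow> 'a bipoly \<Rightarrow> 'a bipoly \<Rightarrow> bool" where
  "invariant_curve P Q g K \<longleftrightarrow> P * partial_z g + Q * partial_y g = K * g"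


section \<open>The geometric genus of an irreducible complex plane curve\<close>

text \<open>
  The geometric genus is the dimension of the space of global regular differentials on the smooth
  projective model \<open>X\<close> of the curve. It is expressed through the function field \<open>F\<close> of the curve:
  the points of \<open>X\<close> (those over the line at infinity included) correspond to the valuation rings
  of \<open>F\<close> over \<open>\<complex>\<close>, via the local rings of \<open>X\<close>; a differential of \<open>F\<close> over \<open>\<complex>\<close> is regular at a point
  iff it lies in the module of differentials of the local ring \<open>V\<close> there, that is, iff it is a
  finite sum of terms \<open>a db\<close> with \<open>a\<close> and \<open>b\<close> in \<open>V\<close>.

  To have \<open>F\<close> inside a fixed field, it is generated over \<open>\<complex>\<close> by the coordinates of a generic point
  of the curve with coordinates in \<open>\<complex>((t))\<close>. Every irreducible curve \<open>g = 0\<close> has one, given by a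
  parametrisation of any of its branches, and for every choice \<open>F\<close> is isomorphic over \<open>\<complex>\<close> to the
  field of fractions of \<open>\<complex>[z, y]/(g)\<close>.
\<close>

definition bieval :: "complex bipoly \<Rightarrow> complex fls \<Rightarrow> complex fls \<Rightarrow> complex fls" where
  "bieval f a b = poly (map_poly (\<lambda>c. poly (map_poly fls_const c) a) f) b"

definition generic_point :: "complex bipoly \<Rightarrow> complex fls \<Rightarrow> complex fls \<Rightarrow> bool" where
  "generic_point g a b \<longleftrightarrow> (\<forall>h. bieval h a b = 0 \<longleftrightarrow> g dvd h)"

definition generated_field :: "complex fls \<Rightarrow> complex fls \<Rightarrow> complex fls set" where
  "generated_field a b = {bieval r a b / bieval s a b |r s. bieval s a b \<noteq> 0}"

text \<open>
  Since \<open>V\<close> contains the constants, closure under sums and products makes it a subring.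
\<close>

definition is_place :: "complex fls set \<Rightarrow> complex fls set \<Rightarrow> bool" where
  "is_place F V \<longleftrightarrow>
     range fls_const \<subseteq> V \<and> V \<subset> F \<and>
     (\<forall>u\<in>V. \<forall>v\<in>V. u + v \<in> V \<and> u * v \<in> V) \<and>
     (\<forall>u\<in>F. u \<in> V \<or> inverse u \<in> V)"

text \<open>
  Only the values of a derivation on \<open>F\<close> matter.
\<close>

definition derivations :: "complex fls set \<Rightarrow> (complex fls \<Rightarrow> complex fls) set" where
  "derivations F = {D. D ` F \<subseteq> F \<and> (\<forall>c. D (fls_const c) = 0) \<and>
     (\<forall>u\<in>F. \<forall>v\<in>F. D (u + v) = D u + D v \<and> D (u * v) = D u * v + u * D v)}"

text \<open>
  The module of differentials of \<open>F\<close> over \<open>\<complex>\<close> is finite-dimensional over \<open>F\<close>, so it is identified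
  with its image in its bidual: a differential is a function on the derivations of \<open>F\<close>, extended by
  \<open>0\<close>, and \<open>db\<close> is the function mapping \<open>D\<close> to \<open>D b\<close>.
\<close>

type_synonym diff_form = "(complex fls \<Rightarrow> complex fls) \<Rightarrow> complex fls"

definition differential :: "complex fls set \<Rightarrow> complex fls \<Rightarrow> diff_form" where
  "differential F b = (\<lambda>D. if D \<in> derivations F then D b else 0)"

text \<open>The image in the differentials of \<open>F\<close> of the differentials of a subring \<open>A\<close> of \<open>F\<close>:\<close>

definition diff_forms :: "complex fls set \<Rightarrow> complex fls set \<Rightarrow> diff_form set" where
  "diff_forms F A = {\<omega>. \<exists>(n::nat) a b. (\<forall>i<n. a i \<in> A \<and> b i \<in> A) \<and>
     \<omega> = (\<lambda>D. \<Sum>i<n. a i * differential F (b i) D)}"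

definition regular_forms :: "complex fls set \<Rightarrow> diff_form set" where
  "regular_forms F = {\<omega> \<in> diff_forms F F. \<forall>V. is_place F V \<longrightarrow> \<omega> \<in> diff_forms F V}"

definition scale_form :: "complex \<Rightarrow> diff_form \<Rightarrow> diff_form" where
  "scale_form c \<omega> = (\<lambda>D. fls_const c * \<omega> D)"

lemma vector_space_scale_form: "vector_space scale_form"
  by unfold_locales
     (auto simp: scale_form_def fun_eq_iff algebra_simps fls_const_mult_const
           simp flip: fls_plus_const)

definition function_field_genus :: "complex fls set \<Rightarrow> nat" where
  "function_field_genus F = vector_space.dim scale_form (regular_forms F)"

definition geometric_genus :: "complex bipoly \<Rightarrow> nat" where
  "geometric_genus g =
     (let (a, b) = SOME (a, b). generic_point g a b in function_field_genus (generated_field a b))"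


section \<open>The system and the curve\<close>

definition sysP :: "real bipoly" where
  "sysP = Z * Y + 1"

definition sysQ :: "real \<Rightarrow> real bipoly" where
  "sysQ q = 3 * Y^2 - bconst (8/13 * q) * Z * Y - bconst (24/169 * q^2) * Z^2 + bconst q"

text \<open>
  If \<open>169 p = 192 q\<^sup>2\<close>, then \<open>g\<close> is the cube of a polynomial of degree \<open>6\<close> whose curve has genus \<open>0\<close>;
  if \<open>169 p = - 240 q\<^sup>2\<close>, then \<open>g\<close> is the square of a polynomial of degree \<open>9\<close>.
\<close>

definition curve_g :: "real \<Rightarrow> real \<Rightarrow> real bipoly" where
  "curve_g p q =
     bconst (16777216/23298085122481 * q^12) * Z^18
   - bconst (50331648/1792160394037 * q^11) * Z^16
   + bconst (12582912/137858491849 * q^10) * Y * Z^15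
   + bconst (60555264/137858491849 * q^10) * Z^14
   - bconst (26738688/10604499373 * q^9) * Y * Z^13
   + (- bconst (2818048/815730721 * q^9)
      + bconst (3342336/815730721 * q^8) * Y^2) * Z^12
   + bconst (20840448/815730721 * q^8) * Y * Z^11
   + (bconst (11452416/815730721 * q^8)
      - bconst (1728/4826809 * q^6 * p)
      - bconst (4325376/62748517 * q^7) * Y^2) * Z^10
   + (- bconst (540672/4826809 * q^7) * Y
      + bconst (360448/4826809 * q^6) * Y^3) * Z^9
   + (bconst (2592/371293 * q^5 * p)
      + bconst (1695744/4826809 * q^6) * Y^2
      - bconst (1744896/62748517 * q^7)
      + bconst (288/28561 * q^4 * p) * Y^2) * Z^8
   + (- bconst (196608/371293 * q^5) * Y^3
      + bconst (964608/4826809 * q^6) * Y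
      - bconst (720/28561 * q^4 * p) * Y
      - bconst (64/2197 * q^3 * p) * Y^3) * Z^7
   + (bconst (4/169 * p * q^2) * Y^4
      - bconst (196608/371293 * q^5) * Y^2
      + bconst (132544/4826809 * q^6)
      - bconst (90/2197 * q^4 * p)
      - bconst (264/2197 * q^3 * p) * Y^2
      + bconst (12288/28561 * q^4) * Y^4) * Z^6
   + (bconst (474/2197 * q^3 * p) * Y
      + bconst (18432/28561 * q^4) * Y^3
      - bconst (59136/371293 * q^5) * Y
      + bconst (136/169 * p * q^2) * Y^3) * Z^5
   + (- bconst (5712/371293 * q^5)
      + bconst (241/4394 * p * q^3)
      + bconst (10896/28561 * q^4) * Y^2
      - bconst (69/338 * p * q^2) * Y^2
      - bconst (20/13 * q * p) * Y^4) * Z^4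
   + (- bconst (1/2 * p * q) * Y^3
      - bconst (608/2197 * q^3) * Y^3
      + bconst (1104/28561 * q^4) * Y
      + bconst p * Y^5
      - bconst (11/52 * p * q^2) * Y) * Z^3
   + (bconst (177/2197 * q^4)
      + bconst (3/26 * p * q) * Y^2
      + bconst (204/169 * q^2) * Y^4
      + bconst (1224/2197 * q^3) * Y^2
      + bconst (3/4 * p) * Y^4
      - bconst (23/832 * p * q^2)) * Z^2
   + (bconst (3/16 * p) * Y^3
      + bconst (23/416 * p * q) * Y
      - bconst (354/2197 * q^3) * Y
      - bconst (180/169 * q^2) * Y^3
      - bconst (24/13 * q) * Y^5) * Z
   + Y^6
   + bconst (15/2197 * q^3)
   + bconst (9/13 * q) * Y^4
   + bconst (1/208 * p * q)
   + bconst (1/64 * p) * Y^2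
   + bconst (24/169 * q^2) * Y^2"

end

theory Submission
  imports Defs
begin

text \<open>
  The first integral of the system is \<open>S\<^sup>3 / (L\<^sup>3 M)\<close> for three invariant polynomials \<open>S\<close>, \<open>L\<close>, \<open>M\<close> of
  degrees 6, 2, 4, and \<open>g\<close> is one of its level sets. The symmetry \<open>(z, y) \<mapsto> (-z, -y)\<close> restricts to
  a curve as an involution that fixes the six points over the line at infinity; it is the
  hyperelliptic involution, the quotient has a coordinate \<open>t\<close>, and the curve is birational to
  \<open>v\<^sup>2 = f(t)\<close> for a polynomial \<open>f\<close> of degree 6, which has simple roots unless \<open>p\<close> is one of the two
  exceptional values. The generic point of \<open>v\<^sup>2 = f(t)\<close> is mapped to a point at which \<open>g\<close> vanishes,
  and since \<open>z\<close> has six simple poles, \<open>y\<close> has degree 6 over \<open>\<complex>(z)\<close>; so this point is generic, which also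
  yields irreducibility. The regular differentials of \<open>v\<^sup>2 = f(t)\<close> are spanned by \<open>dt/v\<close> and \<open>t dt/v\<close>:
  other differentials have a pole along some branch \<open>t = c + s\<^sup>2\<close> or \<open>t = 1/s\<^sup>2\<close>.
\<close>

section \<open>Evaluation of polynomials under a homomorphism of the coefficients\<close>

text \<open>The genus refers to all valuation rings of a field generated by a point that
  \<open>SOME\<close> selects, so neither the field nor its places are known explicitly. A branch of
  \<open>v^2 = f(t)\<close> is an embedding of the function field into Laurent series, and the power
  series pull back to a place; such places suffice to bound the regular differentials from above.
  That \<open>dt/v\<close> and \<open>t dt/v\<close> are regular is shown at an arbitrary place,
  from the valuation ring property alone. The choice of the generic point is harmless because its
  vanishing ideal determines the field up to an isomorphism fixing the constants.

  Origin of the exceptional values: with \<open>q = 13 k\<close> and \<open>p = 64 r\<close> the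
  curve is the level \<open>3 k^2 - r\<close> of the first integral, and the parametrised curve has
  level \<open>27 k^2/(4 - d)\<close>, which defines \<open>d\<close>. Level 0 means
  \<open>169 p = 192 q^2\<close>; \<open>d = 0\<close>, where \<open>f\<close> degenerates to a
  constant, means \<open>169 p = - 240 q^2\<close>; and \<open>d = 4\<close>, where \<open>f\<close>
  gets a multiple root, would be an infinite level.\<close>

locale coeff_hom =
  fixes h :: "'a::comm_ring_1 \<Rightarrow> 'b::comm_ring_1"
  assumes hom_add: "h (x + y) = h x + h y" and hom_mult: "h (x * y) = h x * h y" and hom_1: "h 1 = 1"
begin

definition ev :: "'a poly \<Rightarrow> 'b \<Rightarrow> 'b" where
  "ev p x = poly (map_poly h p) x"

lemma hom_0: "h 0 = 0"
  using hom_add[of 0 0] by simp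

lemma hom_uminus: "h (- x) = - h x"
  using hom_add[of x "- x"] by (simp add: hom_0 eq_neg_iff_add_eq_0 add.commute)

lemma ev_0 [simp]: "ev 0 x = 0"
  by (simp add: ev_def)

lemma ev_pCons [simp]: "ev (pCons c p) x = h c + x * ev p x"
  by (simp add: ev_def map_poly_pCons hom_0)

lemma ev_1 [simp]: "ev 1 x = 1"
  by (simp add: one_pCons hom_1)

lemma ev_add [simp]: "ev (p + q) x = ev p x + ev q x"
proof (induction p arbitrary: q)
  case (pCons c p)
  show ?case
    by (cases q; simp add: pCons.IH hom_add; simp add: algebra_simps)
qed simp

lemma ev_smult [simp]: "ev (smult c p) x = h c * ev p x"
  by (induction p) (simp_all add: hom_mult algebra_simps)

lemma ev_mult [simp]: "ev (p * q) x = ev p x * ev q x"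
  by (induction p) (simp_all add: hom_0 algebra_simps)

lemma ev_uminus [simp]: "ev (- p) x = - ev p x"
  by (induction p) (simp_all add: hom_uminus algebra_simps)

lemma ev_diff [simp]: "ev (p - q) x = ev p x - ev q x"
  using ev_add[of p "- q"] by (simp del: ev_add)

lemma ev_power [simp]: "ev (p ^ n) x = ev p x ^ n"
  by (induction n) simp_all

end

interpretation fls: coeff_hom fls_const
  by standard (simp_all add: fls_plus_const)

abbreviation pev :: "complex poly \<Rightarrow> complex fls \<Rightarrow> complex fls" where
  "pev \<equiv> fls.ev"

text \<open>\<open>bieval\<close> evaluates in two layers, the coefficients at \<open>a\<close> and
  then the polynomial in \<open>y\<close> at \<open>b\<close>; the inner layer is the coefficient
  homomorphism of the outer one.\<close>

interpretation bi: coeff_hom "\<lambda>c. pev c a" for a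
  by standard simp_all

lemma bieval_conv_ev: "bieval f a b = bi.ev a f b"
  by (subst bi.ev_def) (simp add: bieval_def fls.ev_def)

lemma bieval_0 [simp]: "bieval 0 a b = 0"
  and bieval_1 [simp]: "bieval 1 a b = 1"
  and bieval_pCons [simp]: "bieval (pCons c f) a b = pev c a + b * bieval f a b"
  and bieval_add [simp]: "bieval (f + g) a b = bieval f a b + bieval g a b"
  and bieval_diff [simp]: "bieval (f - g) a b = bieval f a b - bieval g a b"
  and bieval_mult [simp]: "bieval (f * g) a b = bieval f a b * bieval g a b"
  by (simp_all add: bieval_conv_ev)

text \<open>Over the complex numbers linear factors can be split off until one of them vanishes at
  \<open>a\<close>. Hence nonconstant Laurent series are transcendental over the constants.\<close>

lemma pev_root:
  assumes "pev p a = 0" "p \<noteq> 0"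
  shows "\<exists>c. a = fls_const c"
  using assms
proof (induction "degree p" arbitrary: p)
  case 0
  then obtain c where "p = [:c:]" by (metis degree_eq_zeroE)
  with 0 show ?case by simp
next
  case (Suc n)
  then have "\<not> constant (poly p)" by (simp add: constant_degree)
  then obtain c where "poly p c = 0" using fundamental_theorem_of_algebra by blast
  then obtain r where r: "p = [:-c, 1:] * r" by (metis poly_eq_0_iff_dvd dvdE)
  with Suc have "r \<noteq> 0" by auto
  then have "degree r = n" using Suc(2) unfolding r by (subst (asm) degree_mult_eq) auto
  moreover have "a = fls_const c \<or> pev r a = 0"
    using Suc(3) unfolding r fls.ev_mult by (simp add: fls.hom_uminus)
  ultimately show ?case using Suc \<open>r \<noteq> 0\<close> by blast
qed

lemma pev_eq_0_iff:
  assumes "a \<notin> range fls_const"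
  shows "pev p a = 0 \<longleftrightarrow> p = 0"
  using pev_root[of p a] assms by auto


section \<open>Generated fields\<close>

text \<open>Applied with \<open>A\<close> a generated field, a place, the regular series or the
  kernel of a derivation.\<close>

lemma pev_in_closed:
  assumes "range fls_const \<subseteq> A" "\<And>x y. x \<in> A \<Longrightarrow> y \<in> A \<Longrightarrow> x + y \<in> A \<and> x * y \<in> A" "a \<in> A"
  shows "pev p a \<in> A"
proof (induction p)
  case 0
  show ?case using assms(1) by (metis fls.ev_0 fls_const_0 range_subsetD)
next
  case (pCons c p)
  moreover have "fls_const c \<in> A" using assms(1) by auto
  ultimately show ?case by (simp add: assms(2,3))
qed

lemma bieval_in_closed:
  assumes "range fls_const \<subseteq> A" "\<And>x y. x \<in> A \<Longrightarrow> y \<in> A \<Longrightarrow> x + y \<in> A \<and> x * y \<in> A" "a \<in> A" "b \<in> A"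
  shows "bieval f a b \<in> A"
proof (induction f)
  case 0
  show ?case using assms(1) by (metis bieval_0 fls_const_0 range_subsetD)
next
  case (pCons c f)
  then show ?case using pev_in_closed[OF assms(1-3), of c] by (simp add: assms(2,4))
qed

context
  fixes a b :: "complex fls"
begin

private abbreviation "F \<equiv> generated_field a b"

lemma generated_field_bieval: "bieval r a b \<in> F"
proof -
  have "bieval r a b = bieval r a b / bieval 1 a b" "bieval 1 a b \<noteq> 0" by simp_all
  then show ?thesis unfolding generated_field_def by blast
qed

lemma generated_field_const: "fls_const c \<in> F"
  using generated_field_bieval[of "[:[:c:]:]"] by simp

lemma generated_field_gen1: "a \<in> F"
  using generated_field_bieval[of "[:[:0, 1:]:]"] by simp

lemma generated_field_gen2: "b \<in> F"
  using generated_field_bieval[of "[:0, 1:]"] by simp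

lemma generated_field_pev: "pev p a \<in> F"
  using generated_field_bieval[of "[:p:]"] by simp

lemma generated_fieldE:
  assumes "x \<in> F"
  obtains r s where "bieval s a b \<noteq> 0" "x = bieval r a b / bieval s a b"
  using assms unfolding generated_field_def by blast

lemma generated_field_add: "x \<in> F \<Longrightarrow> y \<in> F \<Longrightarrow> x + y \<in> F"
proof (elim generated_fieldE)
  fix r s r' s'
  assume "bieval s a b \<noteq> 0" "x = bieval r a b / bieval s a b"
    "bieval s' a b \<noteq> 0" "y = bieval r' a b / bieval s' a b"
  then have "x + y = bieval (r * s' + r' * s) a b / bieval (s * s') a b" "bieval (s * s') a b \<noteq> 0"
    by (simp_all add: add_frac_eq)
  then show ?thesis unfolding generated_field_def by blast
qed

lemma generated_field_mult: "x \<in> F \<Longrightarrow> y \<in> F \<Longrightarrow> x * y \<in> F"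
proof (elim generated_fieldE)
  fix r s r' s'
  assume "bieval s a b \<noteq> 0" "x = bieval r a b / bieval s a b"
    "bieval s' a b \<noteq> 0" "y = bieval r' a b / bieval s' a b"
  then have "x * y = bieval (r * r') a b / bieval (s * s') a b" "bieval (s * s') a b \<noteq> 0"
    by simp_all
  then show ?thesis unfolding generated_field_def by blast
qed

lemma generated_field_inverse: "x \<in> F \<Longrightarrow> inverse x \<in> F"
proof (elim generated_fieldE)
  fix r s
  assume *: "bieval s a b \<noteq> 0" "x = bieval r a b / bieval s a b"
  show ?thesis
  proof (cases "bieval r a b = 0")
    case True
    then show ?thesis using * generated_field_const[of 0] by simp
  next
    case False
    then show ?thesis using * unfolding generated_field_def by (force simp: field_simps)
  qed
qed

lemma generated_field_divide: "x \<in> F \<Longrightarrow> y \<in> F \<Longrightarrow> x / y \<in> F"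
  by (simp add: field_class.field_divide_inverse generated_field_mult generated_field_inverse)

lemma generated_field_numeral: "numeral n \<in> F"
  using generated_field_const[of "numeral n"] by simp

lemma generated_field_1: "1 \<in> F"
  using generated_field_const[of 1] by simp

lemma generated_field_0: "0 \<in> F"
  using generated_field_const[of 0] by simp

lemma generated_field_uminus: "x \<in> F \<Longrightarrow> - x \<in> F"
  using generated_field_mult[OF generated_field_const[of "-1"], of x] by (simp add: fls.hom_uminus)

lemma generated_field_diff: "x \<in> F \<Longrightarrow> y \<in> F \<Longrightarrow> x - y \<in> F"
  using generated_field_add[OF _ generated_field_uminus, of x y] by simp

lemma generated_field_power: "x \<in> F \<Longrightarrow> x ^ n \<in> F"
  by (induction n) (simp_all add: generated_field_1 generated_field_mult)

lemmas generated_field_intros =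
  generated_field_gen1 generated_field_gen2 generated_field_pev generated_field_const
  generated_field_add generated_field_mult generated_field_divide generated_field_inverse
  generated_field_numeral generated_field_1 generated_field_0 generated_field_uminus
  generated_field_diff generated_field_power

end

lemma generated_field_subset:
  assumes "a' \<in> generated_field a b" "b' \<in> generated_field a b"
  shows "generated_field a' b' \<subseteq> generated_field a b"
proof
  fix x assume "x \<in> generated_field a' b'"
  then obtain r s where "x = bieval r a' b' / bieval s a' b'" by (elim generated_fieldE)
  moreover have "bieval h a' b' \<in> generated_field a b" for h
    by (rule bieval_in_closed) (use assms in \<open>auto intro: generated_field_intros\<close>)
  ultimately show "x \<in> generated_field a b" by (simp add: generated_field_intros)
qed

section \<open>Homomorphisms of function fields and the places they induce\<close>

lemma fls_regular_add:
  "0 \<le> fls_subdegree (x :: complex fls) \<Longrightarrow> 0 \<le> fls_subdegree y \<Longrightarrow> 0 \<le> fls_subdegree (x + y)"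
  using fls_plus_subdegree[of x y] by (cases "x + y = 0") (auto simp: min_def split: if_splits)

lemma fls_regular_mult:
  "0 \<le> fls_subdegree (x :: complex fls) \<Longrightarrow> 0 \<le> fls_subdegree y \<Longrightarrow> 0 \<le> fls_subdegree (x * y)"
  by (cases "x = 0 \<or> y = 0") auto

text \<open>Only the values on \<open>F\<close> matter.\<close>

definition field_hom :: "complex fls set \<Rightarrow> (complex fls \<Rightarrow> complex fls) \<Rightarrow> bool" where
  "field_hom F \<phi> \<longleftrightarrow> (\<forall>c. \<phi> (fls_const c) = fls_const c) \<and>
     (\<forall>x\<in>F. \<forall>y\<in>F. \<phi> (x + y) = \<phi> x + \<phi> y \<and> \<phi> (x * y) = \<phi> x * \<phi> y)"

locale gen_field_hom =
  fixes a b :: "complex fls" and F \<phi>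
  assumes F_def: "F = generated_field a b" and hom: "field_hom F \<phi>"
begin

lemmas F_intros = generated_field_intros[where a = a and b = b, folded F_def]

lemma phi_const [simp]: "\<phi> (fls_const c) = fls_const c"
  and phi_add: "x \<in> F \<Longrightarrow> y \<in> F \<Longrightarrow> \<phi> (x + y) = \<phi> x + \<phi> y"
  and phi_mult: "x \<in> F \<Longrightarrow> y \<in> F \<Longrightarrow> \<phi> (x * y) = \<phi> x * \<phi> y"
  using hom by (auto simp: field_hom_def)

lemma phi_numeral [simp]: "\<phi> (numeral k) = numeral k"
  using phi_const[of "numeral k"] by (simp del: phi_const)

lemma phi_0 [simp]: "\<phi> 0 = 0" and phi_1 [simp]: "\<phi> 1 = 1"
  using phi_const[of 0] phi_const[of 1] by (simp_all del: phi_const)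

lemma phi_uminus: "x \<in> F \<Longrightarrow> \<phi> (- x) = - \<phi> x"
  using phi_add[of x "- x"] by (simp add: F_intros eq_neg_iff_add_eq_0 add.commute)

lemma phi_diff: "x \<in> F \<Longrightarrow> y \<in> F \<Longrightarrow> \<phi> (x - y) = \<phi> x - \<phi> y"
  using phi_add[of x "- y"] by (simp add: F_intros phi_uminus)

lemma phi_eq_0_iff: "x \<in> F \<Longrightarrow> \<phi> x = 0 \<longleftrightarrow> x = 0"
proof
  assume "x \<in> F" "\<phi> x = 0"
  then show "x = 0" using phi_mult[of x "inverse x"] by (cases "x = 0") (auto simp: F_intros)
qed auto

lemma phi_inverse: "x \<in> F \<Longrightarrow> \<phi> (inverse x) = inverse (\<phi> x)"
proof (cases "x = 0")
  case False
  assume "x \<in> F"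
  then have "\<phi> x * \<phi> (inverse x) = 1" using phi_mult[of x "inverse x"] False by (simp add: F_intros)
  then show ?thesis by (metis inverse_unique)
qed simp

lemma phi_divide: "x \<in> F \<Longrightarrow> y \<in> F \<Longrightarrow> \<phi> (x / y) = \<phi> x / \<phi> y"
  by (simp add: field_class.field_divide_inverse phi_mult phi_inverse F_intros)

lemma phi_power: "x \<in> F \<Longrightarrow> \<phi> (x ^ n) = \<phi> x ^ n"
  by (induction n) (simp_all add: phi_mult F_intros)

lemma phi_pev: "x \<in> F \<Longrightarrow> \<phi> (pev p x) = pev p (\<phi> x)"
proof (induction p)
  case (pCons c p)
  have "pev p x \<in> F" using pCons(3) by (intro pev_in_closed) (auto simp: F_intros)
  with pCons show ?case by (simp add: phi_add phi_mult F_intros)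
qed simp

lemma phi_bieval: "x \<in> F \<Longrightarrow> y \<in> F \<Longrightarrow> \<phi> (bieval h x y) = bieval h (\<phi> x) (\<phi> y)"
proof (induction h)
  case (pCons c h)
  have "pev c x \<in> F" "bieval h x y \<in> F"
    using pCons(3,4) by (auto intro!: pev_in_closed bieval_in_closed simp: F_intros)
  with pCons show ?case by (simp add: phi_add phi_mult phi_pev F_intros)
qed simp

lemmas phi_simps = phi_add phi_mult phi_uminus phi_diff phi_inverse phi_divide phi_power phi_pev
  phi_bieval

text \<open>The local ring at the point parametrised by the branch \<open>\<phi>\<close>. The zero
  series has subdegree 0, so it counts as regular.\<close>

definition pullback :: "complex fls set" where
  "pullback = {x \<in> F. 0 \<le> fls_subdegree (\<phi> x)}"

lemma is_place_pullback:
  assumes "x0 \<in> F" "fls_subdegree (\<phi> x0) < 0"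
  shows "is_place F pullback"
  unfolding is_place_def
proof (intro conjI ballI)
  show "range fls_const \<subseteq> pullback" by (auto simp: pullback_def F_intros)
  have "x0 \<notin> pullback" "pullback \<subseteq> F" using assms by (auto simp: pullback_def)
  then show "pullback \<subset> F" using assms(1) by blast
next
  fix x y assume *: "x \<in> pullback" "y \<in> pullback"
  then show "x + y \<in> pullback" "x * y \<in> pullback"
    by (auto simp: pullback_def phi_add phi_mult F_intros fls_regular_add fls_regular_mult)
next
  fix x assume "x \<in> F"
  then show "x \<in> pullback \<or> inverse x \<in> pullback"
    by (auto simp: pullback_def phi_inverse F_intros fls_inverse_subdegree)
qed

end

definition same_relations :: "complex fls \<Rightarrow> complex fls \<Rightarrow> complex fls \<Rightarrow> complex fls \<Rightarrow> bool" where
  "same_relations a b a' b' \<longleftrightarrow> (\<forall>h. bieval h a b = 0 \<longleftrightarrow> bieval h a' b' = 0)"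

text \<open>Cross multiplication turns the equality of two fractions at \<open>(a, b)\<close> into a
  polynomial relation, which then holds at \<open>(a', b')\<close>; so sending a fraction to the
  same fraction at \<open>(a', b')\<close> is well defined.\<close>

lemma field_hom_exists:
  assumes "same_relations a b a' b'"
  shows "\<exists>\<phi>. field_hom (generated_field a b) \<phi> \<and> \<phi> a = a' \<and> \<phi> b = b' \<and>
    \<phi> ` generated_field a b = generated_field a' b'"
proof -
  define R where "R x y \<longleftrightarrow> (\<exists>r s. bieval s a b \<noteq> 0 \<and> x = bieval r a b / bieval s a b \<and>
    y = bieval r a' b' / bieval s a' b')" for x y
  have nz: "bieval s a b \<noteq> 0 \<longleftrightarrow> bieval s a' b' \<noteq> 0" for s
    using assms by (auto simp: same_relations_def)
  have uniq: "y = y'" if R: "R x y" "R x y'" for x y y'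
  proof -
    from R obtain r s r' s' where *: "bieval s a b \<noteq> 0" "bieval s' a b \<noteq> 0"
      "x = bieval r a b / bieval s a b" "x = bieval r' a b / bieval s' a b"
      "y = bieval r a' b' / bieval s a' b'" "y' = bieval r' a' b' / bieval s' a' b'"
      unfolding R_def by blast
    have "bieval r a b / bieval s a b = bieval r' a b / bieval s' a b" using *(3,4) by simp
    then have "bieval (r * s' - r' * s) a b = 0" using *(1,2) by (simp add: frac_eq_eq)
    then have "bieval (r * s' - r' * s) a' b' = 0" using nz by blast
    then have "bieval r a' b' / bieval s a' b' = bieval r' a' b' / bieval s' a' b'"
      using *(1,2) nz by (simp add: frac_eq_eq)
    then show ?thesis using *(5,6) by simp
  qed
  define \<phi> where "\<phi> x = (THE y. R x y)" for x
  have phi: "\<phi> x = y" if "R x y" for x y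
    unfolding \<phi>_def using that uniq by blast
  have ex: "\<exists>y. R x y" if "x \<in> generated_field a b" for x
    using that unfolding generated_field_def R_def by blast
  have b1: "R (bieval h a b) (bieval h a' b')" for h
    unfolding R_def by (intro exI[of _ h] exI[of _ 1]) simp
  have "R (x + x') (y + y') \<and> R (x * x') (y * y')" if R: "R x y" "R x' y'" for x y x' y'
  proof -
    from R obtain r s r' s' where *: "bieval s a b \<noteq> 0" "bieval s' a b \<noteq> 0"
      "x = bieval r a b / bieval s a b" "x' = bieval r' a b / bieval s' a b"
      "y = bieval r a' b' / bieval s a' b'" "y' = bieval r' a' b' / bieval s' a' b'"
      unfolding R_def by blast
    with nz have "bieval s a' b' \<noteq> 0" "bieval s' a' b' \<noteq> 0" by blast+
    with * have "bieval (s * s') a b \<noteq> 0"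
      "x + x' = bieval (r * s' + r' * s) a b / bieval (s * s') a b"
      "y + y' = bieval (r * s' + r' * s) a' b' / bieval (s * s') a' b'"
      "x * x' = bieval (r * r') a b / bieval (s * s') a b"
      "y * y' = bieval (r * r') a' b' / bieval (s * s') a' b'"
      by (simp_all add: add_frac_eq)
    then show ?thesis unfolding R_def by blast
  qed
  note arith = this
  have "\<phi> (fls_const c) = fls_const c" for c
    using b1[of "[:[:c:]:]"] by (simp add: phi)
  moreover have "\<phi> (x + y) = \<phi> x + \<phi> y \<and> \<phi> (x * y) = \<phi> x * \<phi> y"
    if xy: "x \<in> generated_field a b" "y \<in> generated_field a b" for x y
  proof -
    obtain x' y' where "R x x'" "R y y'" using ex xy by blast
    with arith[OF this] show ?thesis by (simp add: phi)
  qed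
  ultimately have "field_hom (generated_field a b) \<phi>"
    unfolding field_hom_def by blast
  moreover have "\<phi> a = a'" "\<phi> b = b'"
    using b1[of "[:[:0, 1:]:]"] b1[of "[:0, 1:]"] by (auto simp: phi)
  moreover have "\<phi> ` generated_field a b = generated_field a' b'"
  proof (intro equalityI subsetI)
    fix y assume "y \<in> \<phi> ` generated_field a b"
    then obtain x where "x \<in> generated_field a b" "y = \<phi> x" by blast
    then obtain r s where rs: "bieval s a b \<noteq> 0" "x = bieval r a b / bieval s a b"
      by (elim generated_fieldE)
    then have "R x (bieval r a' b' / bieval s a' b')" unfolding R_def by blast
    then have "y = bieval r a' b' / bieval s a' b'" using \<open>y = \<phi> x\<close> phi by simp
    then show "y \<in> generated_field a' b'"
      by (simp add: generated_field_divide generated_field_bieval)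
  next
    fix y assume "y \<in> generated_field a' b'"
    then obtain r s where rs: "bieval s a' b' \<noteq> 0" "y = bieval r a' b' / bieval s a' b'"
      by (elim generated_fieldE)
    then have "bieval s a b \<noteq> 0" using nz by blast
    then have "R (bieval r a b / bieval s a b) y" using rs unfolding R_def by blast
    then have "\<phi> (bieval r a b / bieval s a b) = y" by (rule phi)
    then show "y \<in> \<phi> ` generated_field a b"
      using generated_field_divide[OF generated_field_bieval generated_field_bieval] by blast
  qed
  ultimately show ?thesis by blast
qed


section \<open>Laurent series\<close>

lemma fls_regular_half: "0 \<le> fls_subdegree (x + x :: complex fls) \<Longrightarrow> 0 \<le> fls_subdegree x"
  by (cases "x = 0") (simp_all flip: mult_2)

lemma fls_regular_deriv: "0 \<le> fls_subdegree (x :: complex fls) \<Longrightarrow> 0 \<le> fls_subdegree (fls_deriv x)"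
proof (rule fls_subdegree_ge0I)
  fix k :: int assume "k < 0" "0 \<le> fls_subdegree x"
  then show "fls_nth (fls_deriv x) k = 0" by (cases "k = -1") auto
qed

text \<open>An even power of the variable is a square, and the remaining unit has a square root
  because its constant term has one.\<close>

lemma fls_sqrt_exists:
  assumes "even (fls_subdegree (x :: complex fls))"
  shows "\<exists>y. y\<^sup>2 = x"
proof (cases "x = 0")
  case False
  define w where "w = fls_base_factor_to_fps x"
  have w0: "fps_nth w 0 \<noteq> 0" unfolding w_def by (rule fls_base_factor_to_fps_base[OF False])
  define r where "r = fps_radical (\<lambda>_. csqrt) 2 w"
  have "r\<^sup>2 = w"
    using power_radical[OF w0, of "\<lambda>_. csqrt" 1] by (simp add: r_def numeral_2_eq_2[symmetric])
  obtain m where m: "fls_subdegree x = 2 * m" using assms by blast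
  have "(fls_shift (-m) (fps_to_fls r))\<^sup>2 = fls_shift (-m - m) (fps_to_fls (r\<^sup>2))"
    by (simp add: power2_eq_square fls_shifted_times_simps fls_times_fps_to_fls)
  also have "\<dots> = x"
    using fls_conv_base_factor_to_fps_shift_subdegree[of x] unfolding \<open>r\<^sup>2 = w\<close> w_def m
    by (simp add: algebra_simps)
  finally show ?thesis by blast
qed auto

lemma fls_deriv_eq_0:
  assumes "fls_deriv (x :: complex fls) = 0"
  shows "x \<in> range fls_const"
proof -
  have "x = fls_const (fls_nth x 0)"
  proof (rule fls_eqI)
    fix n
    have "fls_nth (fls_deriv x) (n - 1) = 0" using assms by simp
    then show "fls_nth x n = fls_nth (fls_const (fls_nth x 0)) n" by auto
  qed
  then show ?thesis by blast
qed

lemma fls_deriv_pev: "fls_deriv (pev p x) = pev (pderiv p) x * fls_deriv x"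
  by (induction p) (simp_all add: pderiv_pCons algebra_simps)

lemma pev_regular: "0 \<le> fls_subdegree x \<Longrightarrow> 0 \<le> fls_subdegree (pev p x)"
  using pev_in_closed[of "{x. 0 \<le> fls_subdegree x}" x p]
  by (auto simp: fls_regular_add fls_regular_mult image_subset_iff)

text \<open>The parameter enters squared so that \<open>f\<close> gets even order along the branch,
  hence a square root, also when \<open>c\<close> is one of its roots.\<close>

lemma pev_shift_subdegree:
  assumes "p \<noteq> 0"
  shows "fls_subdegree (pev p (fls_const c + fls_X\<^sup>2)) = 2 * int (order c p)"
    and "pev p (fls_const c + fls_X\<^sup>2) \<noteq> 0"
proof -
  let ?\<alpha> = "fls_const c + fls_X\<^sup>2 :: complex fls"
  obtain r where r: "p = [:-c, 1:] ^ order c p * r" "\<not> [:-c, 1:] dvd r"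
    using order_decomp[OF assms] by blast
  have root: "poly r c \<noteq> 0" using r(2) by (simp add: poly_eq_0_iff_dvd)
  have "[:-c, 1:] dvd r - [:poly r c:]" by (simp flip: poly_eq_0_iff_dvd)
  then obtain r' where r': "r = [:poly r c:] + [:-c, 1:] * r'"
    by (metis add.commute diff_add_cancel dvdE)
  have X: "pev [:-c, 1:] ?\<alpha> = fls_X\<^sup>2" by (simp add: fls.hom_uminus)
  have sub: "fls_subdegree (fls_X\<^sup>2 :: complex fls) = 2" by (simp add: power2_eq_square)
  have alpha: "0 \<le> fls_subdegree ?\<alpha>" by (intro fls_regular_add) (simp_all add: sub)
  have eq: "pev r ?\<alpha> = fls_const (poly r c) + fls_X\<^sup>2 * pev r' ?\<alpha>"
    by (subst r', subst fls.ev_add, subst fls.ev_mult, subst X) simp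
  have "fls_nth (fls_X\<^sup>2 * pev r' ?\<alpha>) 0 = 0"
  proof (cases "pev r' ?\<alpha> = 0")
    case False
    then have "fls_subdegree (fls_X\<^sup>2 * pev r' ?\<alpha>) = 2 + fls_subdegree (pev r' ?\<alpha>)"
      using sub by simp
    then show ?thesis using pev_regular[OF alpha, of r'] by (intro fls_eq0_below_subdegree) linarith
  qed simp
  then have nth: "fls_nth (pev r ?\<alpha>) 0 \<noteq> 0" using root by (simp add: eq)
  then have "fls_subdegree (pev r ?\<alpha>) \<le> 0" by (rule fls_subdegree_leI)
  with pev_regular[OF alpha, of r] have "fls_subdegree (pev r ?\<alpha>) = 0" by linarith
  moreover have nz: "pev r ?\<alpha> \<noteq> 0" using nth by auto
  moreover have p: "pev p ?\<alpha> = (fls_X\<^sup>2) ^ order c p * pev r ?\<alpha>"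
    by (subst r(1), subst fls.ev_mult, subst fls.ev_power, subst X) simp
  moreover have "fls_subdegree ((fls_X\<^sup>2) ^ k :: complex fls) = 2 * int k" for k
    by (induction k) (simp_all add: sub)
  ultimately show "fls_subdegree (pev p ?\<alpha>) = 2 * int (order c p)" by simp
  show "pev p ?\<alpha> \<noteq> 0" using p nz by simp
qed

lemma pev_infinity_subdegree:
  assumes "p \<noteq> 0"
  shows "fls_subdegree (pev p (fls_X_inv\<^sup>2)) = - 2 * int (degree p) \<and> pev p (fls_X_inv\<^sup>2) \<noteq> 0"
  using assms
proof (induction p)
  case (pCons c p)
  have sub: "fls_subdegree (fls_X_inv\<^sup>2 :: complex fls) = -2" by (simp add: power2_eq_square)
  show ?case
  proof (cases "p = 0")
    case True
    then show ?thesis using pCons by simp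
  next
    case False
    with pCons have IH: "fls_subdegree (pev p (fls_X_inv\<^sup>2)) = - 2 * int (degree p)"
      "pev p (fls_X_inv\<^sup>2) \<noteq> 0" by blast+
    let ?y = "fls_X_inv\<^sup>2 * pev p (fls_X_inv\<^sup>2) :: complex fls"
    have y: "?y \<noteq> 0" "fls_subdegree ?y = - 2 - 2 * int (degree p)" using IH sub by simp_all
    then have "fls_subdegree (fls_const c + ?y) = fls_subdegree ?y"
      by (intro fls_subdegree_add_eq2) auto
    moreover from this y(2) have "fls_const c + ?y \<noteq> 0" by auto
    ultimately show ?thesis using y(2) False by simp
  qed
qed simp

section \<open>Divisibility and Bezout relations of complex polynomials\<close>

lemma order_le_imp_dvd:
  fixes p q :: "complex poly"
  assumes "p \<noteq> 0" "q \<noteq> 0" "\<And>c. order c p \<le> order c q"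
  shows "p dvd q"
  using assms
proof (induction "degree p" arbitrary: p q)
  case 0
  then show ?case by (metis degree_eq_zeroE is_unit_const_poly_iff is_unit_iff_degree unit_imp_dvd)
next
  case (Suc n)
  then have "\<not> constant (poly p)" by (simp add: constant_degree)
  then obtain c where c: "poly p c = 0" using fundamental_theorem_of_algebra by blast
  then have "order c q \<noteq> 0" using Suc(3) Suc(5)[of c] by (metis le_zero_eq order_root)
  then have "poly q c = 0" using order_root by blast
  then obtain p' q' where *: "p = [:-c, 1:] * p'" "q = [:-c, 1:] * q'"
    using c by (meson dvdE poly_eq_0_iff_dvd)
  with Suc have nz: "p' \<noteq> 0" "q' \<noteq> 0" by auto
  have "degree p' = n" using Suc(2) nz unfolding * by (subst (asm) degree_mult_eq) auto
  moreover have "order z p' \<le> order z q'" for z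
  proof -
    have "order z p = order z [:-c, 1:] + order z p'" "order z q = order z [:-c, 1:] + order z q'"
      using order_mult[of "[:-c, 1:]" p' z] order_mult[of "[:-c, 1:]" q' z] Suc(3,4)
      unfolding * by blast+
    then show ?thesis using Suc(5)[of z] by simp
  qed
  ultimately show ?case using Suc(1) nz unfolding * by (intro mult_dvd_mono) auto
qed


text \<open>A nonzero element of least degree in the ideal of \<open>p\<close> and \<open>q\<close>
  divides both, so a root of it would be a common root; hence it is constant.\<close>

lemma poly_bezout:
  fixes p q :: "complex poly"
  assumes "p \<noteq> 0" "\<And>z. \<not> (poly p z = 0 \<and> poly q z = 0)"
  shows "\<exists>\<alpha> \<beta>. \<alpha> * p + \<beta> * q = 1"
proof -
  define I where "I d \<longleftrightarrow> d \<noteq> 0 \<and> (\<exists>\<alpha> \<beta>. d = \<alpha> * p + \<beta> * q)" for d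
  have "p = 1 * p + 0 * q" by simp
  then have "I p" unfolding I_def using assms(1) by blast
  then obtain d where d: "I d" "\<And>e. I e \<Longrightarrow> degree d \<le> degree e"
    using ex_has_least_nat[of I p degree] by blast
  then obtain \<alpha> \<beta> where ab: "d = \<alpha> * p + \<beta> * q" and "d \<noteq> 0" unfolding I_def by blast
  have dvd: "d dvd a * p + b * q" for a b
  proof (rule ccontr)
    let ?x = "a * p + b * q"
    assume "\<not> d dvd ?x"
    then have nz: "?x mod d \<noteq> 0" by (simp add: mod_eq_0_iff_dvd)
    have "?x mod d = ?x - ?x div d * d" by (simp add: minus_div_mult_eq_mod)
    also have "\<dots> = (a - ?x div d * \<alpha>) * p + (b - ?x div d * \<beta>) * q"
      by (simp add: ab algebra_simps)
    finally have "I (?x mod d)" using nz unfolding I_def by blast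
    moreover have "degree (?x mod d) < degree d" using degree_mod_less[OF \<open>d \<noteq> 0\<close>] nz by blast
    ultimately show False using d(2) by fastforce
  qed
  have "poly d z \<noteq> 0" for z
    using assms(2)[of z] dvd[of 1 0] dvd[of 0 1] by (auto simp: poly_eq_0_iff_dvd intro: dvd_trans)
  then have "degree d = 0" using fundamental_theorem_of_algebra constant_degree by blast
  then obtain c where c: "d = [:c:]" using degree_eq_zeroE by blast
  have "smult (inverse c) \<alpha> * p + smult (inverse c) \<beta> * q = smult (inverse c) d"
    by (simp add: ab smult_add_right)
  also have "\<dots> = 1" using c \<open>d \<noteq> 0\<close> by (simp add: one_pCons)
  finally show ?thesis by blast
qed

lemma map_poly_reflect_poly:
  "map_poly fls_const (reflect_poly p) = reflect_poly (map_poly fls_const p)"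
  by (rule poly_eqI) (simp add: coeff_map_poly coeff_reflect_poly degree_map_poly)


section \<open>The genus of a hyperelliptic function field\<close>

text \<open>\<open>u\<close> and \<open>v\<close> are any series satisfying the equation, so the
  branches at finite points and at infinity, and the images of a generic point under a field
  homomorphism, are instances as well.\<close>

locale hyperelliptic =
  fixes f :: "complex poly" and u v :: "complex fls"
  assumes degree_f: "degree f = 6" and squarefree_f: "rsquarefree f"
    and curve: "v\<^sup>2 = pev f u" and nonconst: "u \<notin> range fls_const"
begin

abbreviation F :: "complex fls set" where
  "F \<equiv> generated_field u v"

lemma f_nz: "f \<noteq> 0"
  using degree_f by auto

lemma pev_u_eq_0_iff [simp]: "pev p u = 0 \<longleftrightarrow> p = 0"
  using pev_eq_0_iff[OF nonconst] .

lemma v_nz: "v \<noteq> 0"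
  using curve f_nz by auto

text \<open>\<open>f\<close> has a simple root, where \<open>A^2 = B^2 f\<close> with nonzero
  \<open>B\<close> would equate an even and an odd order.\<close>

lemma independent_1_v:
  assumes "pev A u + pev B u * v = 0"
  shows "A = 0 \<and> B = 0"
proof -
  have "(pev A u)\<^sup>2 = (pev B u)\<^sup>2 * v\<^sup>2"
    using assms by (metis add_eq_0_iff power2_minus power_mult_distrib)
  then have "pev (A\<^sup>2 - B\<^sup>2 * f) u = 0" by (simp add: curve)
  then have "A\<^sup>2 - B\<^sup>2 * f = 0" using pev_u_eq_0_iff by blast
  then have eq: "A\<^sup>2 = B\<^sup>2 * f" by simp
  have "B = 0"
  proof (rule ccontr)
    assume B: "B \<noteq> 0"
    with eq f_nz have A: "A \<noteq> 0" by auto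
    have "\<not> constant (poly f)" by (simp add: constant_degree degree_f)
    then obtain c where "poly f c = 0" using fundamental_theorem_of_algebra by blast
    then have "order c f = 1" by (rule rsquarefree_root_order[OF squarefree_f _ f_nz])
    moreover have "order c (A\<^sup>2) = order c A + order c A"
      "order c (B\<^sup>2 * f) = order c B + order c B + order c f"
      using A B f_nz by (simp_all add: power2_eq_square order_mult)
    ultimately have "2 * order c A = 2 * order c B + 1" using eq by simp
    then show False by presburger
  qed
  then show ?thesis using eq by simp
qed

end

text \<open>\<open>A\<close> and \<open>B\<close> are chosen before \<open>u\<close> and
  \<open>v\<close>: one reduction of \<open>h\<close> serves all branches, so \<open>h\<close>
  vanishes on one exactly when it vanishes on the others.\<close>

lemma bieval_hyperelliptic:
  "\<exists>A B. \<forall>u v. v\<^sup>2 = pev f u \<longrightarrow> bieval h u v = pev A u + pev B u * v"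
proof (induction h)
  case 0
  show ?case by (intro exI[of _ 0]) simp
next
  case (pCons c h)
  then obtain A B where *: "\<And>u v. v\<^sup>2 = pev f u \<Longrightarrow> bieval h u v = pev A u + pev B u * v" by blast
  have "bieval (pCons c h) u v = pev (c + B * f) u + pev A u * v" if "v\<^sup>2 = pev f u" for u v
    using *[OF that] that[symmetric] by (simp add: algebra_simps power2_eq_square)
  then show ?case by blast
qed

lemma hyperelliptic_same_relations:
  assumes "hyperelliptic f u v" "hyperelliptic f u' v'"
  shows "same_relations u v u' v'"
proof -
  interpret a: hyperelliptic f u v by fact
  interpret b: hyperelliptic f u' v' by fact
  have "bieval h u v = 0 \<longleftrightarrow> bieval h u' v' = 0" for h
  proof -
    obtain A B where *: "\<And>u v. v\<^sup>2 = pev f u \<Longrightarrow> bieval h u v = pev A u + pev B u * v"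
      using bieval_hyperelliptic by blast
    have "bieval h u v = 0 \<longleftrightarrow> A = 0 \<and> B = 0"
      using a.independent_1_v by (auto simp: *[OF a.curve])
    moreover have "bieval h u' v' = 0 \<longleftrightarrow> A = 0 \<and> B = 0"
      using b.independent_1_v by (auto simp: *[OF b.curve])
    ultimately show ?thesis by simp
  qed
  then show ?thesis by (simp add: same_relations_def)
qed

context hyperelliptic
begin

lemma F_elem:
  assumes "x \<in> F"
  obtains A B C where "C \<noteq> 0" "x = (pev A u + pev B u * v) / pev C u"
proof -
  obtain r s where rs: "bieval s u v \<noteq> 0" "x = bieval r u v / bieval s u v"
    using assms by (rule generated_fieldE)
  obtain r0 r1 where r: "bieval r u v = pev r0 u + pev r1 u * v"
    using bieval_hyperelliptic[of f r] curve by blast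
  obtain s0 s1 where s: "bieval s u v = pev s0 u + pev s1 u * v"
    using bieval_hyperelliptic[of f s] curve by blast
  \<comment> \<open>The conjugate of the denominator; multiplication by it produces the norm
    \<open>?C\<close>, a polynomial in \<open>u\<close>.\<close>
  let ?t = "pev s0 u + pev (- s1) u * v"
  have t: "?t \<noteq> 0" using independent_1_v[of s0 "- s1"] rs(1) s by auto
  let ?C = "s0\<^sup>2 - s1\<^sup>2 * f"
  have C: "pev ?C u = bieval s u v * ?t"
    by (simp add: s algebra_simps power2_eq_square flip: curve)
  then have "?C \<noteq> 0" using rs(1) t by (metis fls.ev_0 no_zero_divisors)
  have "bieval r u v * ?t = pev (r0 * s0 - r1 * s1 * f) u + pev (r1 * s0 - r0 * s1) u * v"
    by (simp add: r algebra_simps power2_eq_square flip: curve)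
  moreover have "x = bieval r u v * ?t / (bieval s u v * ?t)"
    by (simp only: rs(2) mult_divide_mult_cancel_right[OF t])
  ultimately have "x = (pev (r0 * s0 - r1 * s1 * f) u + pev (r1 * s0 - r0 * s1) u * v) / pev ?C u"
    by (simp only: C)
  with \<open>?C \<noteq> 0\<close> show ?thesis using that by blast
qed

text \<open>A derivation along \<open>\<phi>\<close> that kills \<open>u\<close> also kills
  \<open>v\<close>, because \<open>2 v dv = f'(u) du\<close>, and hence everything they generate.
  With the identity for \<open>\<phi>\<close> this makes all derivations of \<open>F\<close>
  multiples of \<open>deriv_u\<close>; with the embedding of a branch it yields the chain
  rule.\<close>

lemma derivation_unique:
  assumes "gen_field_hom u v F \<phi>"
    and add: "\<And>x y. x \<in> F \<Longrightarrow> y \<in> F \<Longrightarrow> d (x + y) = d x + d y"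
    and mult: "\<And>x y. x \<in> F \<Longrightarrow> y \<in> F \<Longrightarrow> d (x * y) = d x * \<phi> y + \<phi> x * d y"
    and const: "\<And>c. d (fls_const c) = 0" and d_u: "d u = 0" and x: "x \<in> F"
  shows "d x = (0 :: complex fls)"
proof -
  interpret gen_field_hom u v F \<phi> by fact
  let ?K = "{x \<in> F. d x = 0}"
  have K: "range fls_const \<subseteq> ?K" "\<And>x y. x \<in> ?K \<Longrightarrow> y \<in> ?K \<Longrightarrow> x + y \<in> ?K \<and> x * y \<in> ?K" "u \<in> ?K"
    using const d_u by (auto simp: F_intros add mult)
  have "pev f u \<in> ?K" by (rule pev_in_closed) (use K in auto)
  then have "d (v * v) = 0" using curve by (simp add: power2_eq_square)
  then have "2 * (\<phi> v * d v) = 0" using mult[of v v] by (simp add: F_intros algebra_simps)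
  then have "d v = 0" using v_nz phi_eq_0_iff[of v] by (simp add: F_intros)
  then have "v \<in> ?K" by (simp add: F_intros)
  obtain r s where rs: "bieval s u v \<noteq> 0" "x = bieval r u v / bieval s u v"
    using x by (rule generated_fieldE)
  have bi: "bieval h u v \<in> ?K" for h by (rule bieval_in_closed) (use K \<open>v \<in> ?K\<close> in auto)
  have "x * bieval s u v = bieval r u v" using rs by simp
  then have "d x * \<phi> (bieval s u v) = 0" using mult[OF x, of "bieval s u v"] bi[of r] bi[of s] by auto
  moreover have "\<phi> (bieval s u v) \<noteq> 0" using rs(1) bi[of s] phi_eq_0_iff by blast
  ultimately show ?thesis by simp
qed

text \<open>The derivation \<open>d/du\<close>, inherited from the formal derivative of the
  surrounding series field; this replaces an extension of derivations from
  \<open>\<complex>(u)\<close> to \<open>F\<close>.\<close>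

definition deriv_u :: "complex fls \<Rightarrow> complex fls" where
  "deriv_u x = fls_deriv x / fls_deriv u"

lemma fls_deriv_u_nz: "fls_deriv u \<noteq> 0"
  using fls_deriv_eq_0 nonconst by blast

lemma deriv_u_u [simp]: "deriv_u u = 1"
  by (simp add: deriv_u_def fls_deriv_u_nz)

lemma deriv_u_const [simp]: "deriv_u (fls_const c) = 0"
  by (simp add: deriv_u_def)

lemma deriv_u_add: "deriv_u (x + y) = deriv_u x + deriv_u y"
  by (simp add: deriv_u_def add_divide_distrib)

lemma deriv_u_mult: "deriv_u (x * y) = deriv_u x * y + x * deriv_u y"
  by (simp add: deriv_u_def add_divide_distrib)

lemma deriv_u_v: "deriv_u v = pev (pderiv f) u / (2 * v)"
proof -
  have "fls_deriv (v\<^sup>2) = pev (pderiv f) u * fls_deriv u" by (simp add: curve fls_deriv_pev)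
  then have "2 * v * fls_deriv v = pev (pderiv f) u * fls_deriv u"
    by (simp add: power2_eq_square algebra_simps)
  then show ?thesis using v_nz fls_deriv_u_nz by (simp add: deriv_u_def field_simps)
qed

lemma deriv_u_F:
  assumes "x \<in> F"
  shows "deriv_u x \<in> F"
proof -
  let ?K = "{x \<in> F. deriv_u x \<in> F}"
  have bi: "bieval h u v \<in> ?K" for h
    by (rule bieval_in_closed)
      (auto simp: generated_field_intros deriv_u_add deriv_u_mult deriv_u_v)
  obtain r s where rs: "bieval s u v \<noteq> 0" "x = bieval r u v / bieval s u v"
    using assms by (rule generated_fieldE)
  then have "x * bieval s u v = bieval r u v" by simp
  then have "deriv_u x * bieval s u v + x * deriv_u (bieval s u v) = deriv_u (bieval r u v)"
    using deriv_u_mult by metis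
  then have "deriv_u x = (deriv_u (bieval r u v) - x * deriv_u (bieval s u v)) / bieval s u v"
    using rs(1) by (simp add: field_simps)
  then show ?thesis using bi[of r] bi[of s] assms by (simp add: generated_field_intros)
qed

lemma deriv_u_derivation: "deriv_u \<in> derivations F"
  by (auto simp: derivations_def deriv_u_F deriv_u_add deriv_u_mult)

lemma gen_field_hom_id: "gen_field_hom u v F (\<lambda>x. x)"
  by standard (auto simp: field_hom_def)

lemma derivations_eq:
  assumes "D \<in> derivations F" "x \<in> F"
  shows "D x = deriv_u x * D u"
proof -
  have "D x - deriv_u x * D u = 0"
    by (rule derivation_unique[OF gen_field_hom_id, of "\<lambda>x. D x - deriv_u x * D u"])
      (use assms in \<open>auto simp: derivations_def deriv_u_add deriv_u_mult algebra_simps\<close>)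
  then show ?thesis by simp
qed

definition form_du :: "complex fls \<Rightarrow> diff_form" where
  "form_du h = (\<lambda>D. if D \<in> derivations F then h * D u else 0)"

lemma form_du_inject: "form_du h = form_du h' \<longleftrightarrow> h = h'"
proof
  assume "form_du h = form_du h'"
  then have "form_du h deriv_u = form_du h' deriv_u" by simp
  then show "h = h'" by (simp add: form_du_def deriv_u_derivation)
qed simp

lemma diff_forms_conv:
  assumes "A \<subseteq> F"
  shows "\<omega> \<in> diff_forms F A \<longleftrightarrow> (\<exists>(n::nat) a b. (\<forall>i<n. a i \<in> A \<and> b i \<in> A) \<and>
    \<omega> = form_du (\<Sum>i<n. a i * deriv_u (b i)))"
proof -
  have "(\<lambda>D. \<Sum>i<n. a i * differential F (b i) D) = form_du (\<Sum>i<n. a i * deriv_u (b i))"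
    if "\<forall>i<n. b i \<in> A" for n :: nat and a b
  proof
    fix D
    show "(\<Sum>i<n. a i * differential F (b i) D) = form_du (\<Sum>i<n. a i * deriv_u (b i)) D"
    proof (cases "D \<in> derivations F")
      case True
      have "a i * differential F (b i) D = a i * deriv_u (b i) * D u" if "i < n" for i
      proof -
        have "b i \<in> F" using that \<open>\<forall>i<n. b i \<in> A\<close> assms by blast
        then show ?thesis using derivations_eq[OF True, of "b i"] True
          by (simp add: differential_def)
      qed
      then show ?thesis using True by (auto simp: form_du_def sum_distrib_right intro!: sum.cong)
    qed (simp add: form_du_def differential_def)
  qed
  note form_du_eq = this
  show ?thesis unfolding diff_forms_def mem_Collect_eq
    by (intro ex_cong1 conj_cong refl) (subst form_du_eq; auto)
qed

text \<open>The expression is the coefficient of the form pulled back along the branch. At the place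
  \<open>pullback\<close> the form is a sum of terms \<open>a db\<close>, and these become products
  of pole-free series and derivatives of pole-free series. The pole of \<open>x0\<close> makes
  \<open>pullback\<close> a proper subring.\<close>

lemma regular_form_along_branch:
  assumes reg: "form_du h \<in> regular_forms F" and hyp: "hyperelliptic f u' v'"
    and pole: "x0 \<in> generated_field u' v'" "fls_subdegree x0 < 0"
    and h: "h = (pev A u + pev B u * v) / pev C u"
  shows "0 \<le> fls_subdegree ((pev A u' + pev B u' * v') / pev C u' * fls_deriv u')"
proof -
  interpret h': hyperelliptic f u' v' by fact
  obtain \<phi> where phi: "field_hom F \<phi>" "\<phi> u = u'" "\<phi> v = v'" "\<phi> ` F = generated_field u' v'"
    using field_hom_exists[OF hyperelliptic_same_relations[OF hyperelliptic_axioms hyp]] by blast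
  interpret gen_field_hom u v F \<phi> by standard (use phi in auto)
  obtain y0 where y0: "y0 \<in> F" "fls_subdegree (\<phi> y0) < 0" using pole phi(4) by (metis imageE)
  have V: "is_place F pullback" using is_place_pullback[OF y0] .
  have VF: "pullback \<subseteq> F" by (auto simp: pullback_def)
  have "form_du h \<in> diff_forms F pullback" using reg V by (auto simp: regular_forms_def)
  then obtain n :: nat and a b where ab: "\<forall>i<n. a i \<in> pullback \<and> b i \<in> pullback"
    "h = (\<Sum>i<n. a i * deriv_u (b i))"
    unfolding diff_forms_conv[OF VF] by (auto simp: form_du_inject)
  have d: "\<phi> (deriv_u x) * fls_deriv u' = fls_deriv (\<phi> x)" if "x \<in> F" for x
  proof -
    have "\<phi> (deriv_u x) * fls_deriv u' - fls_deriv (\<phi> x) = 0"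
    proof (rule derivation_unique[OF gen_field_hom_axioms, of "\<lambda>x. \<phi> (deriv_u x) * fls_deriv u' - fls_deriv (\<phi> x)"])
    qed (use that phi in \<open>auto simp: deriv_u_add deriv_u_mult deriv_u_F phi_simps F_intros algebra_simps\<close>)
    then show ?thesis by simp
  qed
  have "(\<Sum>i<m. a i * deriv_u (b i)) \<in> F \<and>
    0 \<le> fls_subdegree (\<phi> (\<Sum>i<m. a i * deriv_u (b i)) * fls_deriv u')" if "m \<le> n" for m
    using that
  proof (induction m)
    case (Suc m)
    then have m: "a m \<in> F" "b m \<in> F" "0 \<le> fls_subdegree (\<phi> (a m))" "0 \<le> fls_subdegree (\<phi> (b m))"
      using ab(1) by (auto simp: pullback_def)
    let ?S = "\<Sum>i<m. a i * deriv_u (b i)"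
    have "\<phi> (?S + a m * deriv_u (b m)) * fls_deriv u' =
      \<phi> ?S * fls_deriv u' + \<phi> (a m) * fls_deriv (\<phi> (b m))"
      using Suc m d[of "b m"] by (simp add: phi_simps F_intros deriv_u_F algebra_simps)
    moreover have "0 \<le> fls_subdegree (\<phi> ?S * fls_deriv u' + \<phi> (a m) * fls_deriv (\<phi> (b m)))"
      using Suc m by (intro fls_regular_add fls_regular_mult[of "\<phi> (a m)"] fls_regular_deriv) auto
    ultimately show ?case using Suc m by (simp add: F_intros deriv_u_F)
  qed (simp add: F_intros)
  then have "0 \<le> fls_subdegree (\<phi> h * fls_deriv u')" using ab(2) by blast
  moreover have "\<phi> h = (pev A u' + pev B u' * v') / pev C u'"
    by (simp add: h phi phi_simps F_intros)
  ultimately show ?thesis by simp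
qed

section \<open>Upper bound for the regular differentials\<close>

lemma hyperelliptic_branch:
  assumes "u' \<notin> range fls_const" "v'\<^sup>2 = pev f u'"
  shows "hyperelliptic f u' v'" "hyperelliptic f u' (- v')"
  using assms by (unfold_locales, simp_all add: degree_f squarefree_f)

text \<open>On the branch \<open>t = c + s^2\<close> the differential \<open>dt = 2 s ds\<close>
  adds 1 to an even order, so by parity the quotient has no pole in \<open>t\<close> either. In the
  \<open>B\<close> term at a root of \<open>f\<close> the square root \<open>\<beta>\<close> adds
  one more, which accounts for the factor \<open>f\<close>.\<close>

lemma regular_form_order:
  assumes reg: "form_du h \<in> regular_forms F"
    and h: "h = (pev A u + pev B u * v) / pev C u" and "C \<noteq> 0"
  shows "A \<noteq> 0 \<Longrightarrow> order c C \<le> order c A" "B \<noteq> 0 \<Longrightarrow> order c C \<le> order c (B * f)"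
proof -
  let ?\<alpha> = "fls_const c + fls_X\<^sup>2 :: complex fls"
  note sub = pev_shift_subdegree
  obtain \<beta> where \<beta>: "\<beta>\<^sup>2 = pev f ?\<alpha>"
    using fls_sqrt_exists[of "pev f ?\<alpha>"] sub(1)[OF f_nz, of c] by auto
  have \<beta>nz: "\<beta> \<noteq> 0" using \<beta> sub(2)[OF f_nz, of c] by auto
  have "fls_subdegree (\<beta>\<^sup>2) = 2 * fls_subdegree \<beta>" using \<beta>nz by (simp add: power2_eq_square)
  then have sub\<beta>: "fls_subdegree \<beta> = order c f" using \<beta> sub(1)[OF f_nz, of c] by simp
  have "fls_nth ?\<alpha> 2 = 1" by (simp add: fls_X_power_conv_shift_1)
  then have nc: "?\<alpha> \<notin> range fls_const" by (metis fls_const_nth imageE zero_neq_numeral zero_neq_one)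
  have pole: "inverse (?\<alpha> - fls_const c) \<in> generated_field ?\<alpha> w" for w
    by (intro generated_field_intros)
  have pole': "fls_subdegree (inverse (?\<alpha> - fls_const c)) < 0"
    by (simp add: fls_inverse_subdegree power2_eq_square)
  have deriv: "fls_deriv (fls_X\<^sup>2 :: complex fls) = 2 * fls_X" by (simp add: power2_eq_square)
  let ?a = "pev A ?\<alpha> / pev C ?\<alpha> * (2 * fls_X)" and ?b = "pev B ?\<alpha> * \<beta> / pev C ?\<alpha> * (2 * fls_X)"
  have plus: "0 \<le> fls_subdegree (?a + ?b)"
    using regular_form_along_branch[OF reg hyperelliptic_branch(1)[OF nc \<beta>] pole pole' h]
    by (simp add: deriv add_divide_distrib distrib_right)
  have minus: "0 \<le> fls_subdegree (?a + - ?b)"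
    using regular_form_along_branch[OF reg hyperelliptic_branch(2)[OF nc \<beta>] pole pole' h]
    by (simp add: deriv diff_divide_distrib algebra_simps)
  \<comment> \<open>The conjugate branches share the \<open>A\<close> part and have opposite
    \<open>B\<close> parts; sum and difference isolate the two.\<close>
  have "(?a + ?b) + (?a + - ?b) = ?a + ?a" by simp
  then have a: "0 \<le> fls_subdegree ?a"
    using fls_regular_add[OF plus minus] fls_regular_half by metis
  have "(?a + ?b) + - (?a + - ?b) = ?b + ?b" by simp
  moreover have "0 \<le> fls_subdegree (- (?a + - ?b))" using minus by (simp only: fls_uminus_subdegree)
  ultimately have b: "0 \<le> fls_subdegree ?b"
    using fls_regular_add[OF plus] fls_regular_half by metis
  have C: "pev C ?\<alpha> \<noteq> 0" using sub(2)[OF \<open>C \<noteq> 0\<close>] .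
  have X2: "fls_subdegree (2 * fls_X :: complex fls) = 1" by simp
  show "order c C \<le> order c A" if "A \<noteq> 0"
  proof -
    have "fls_subdegree ?a = 2 * int (order c A) - 2 * int (order c C) + 1"
      using sub[OF that, of c] sub[OF \<open>C \<noteq> 0\<close>, of c] by (simp add: fls_divide_subdegree)
    with a show ?thesis by linarith
  qed
  show "order c C \<le> order c (B * f)" if "B \<noteq> 0"
  proof -
    have "fls_subdegree ?b = 2 * int (order c B) + int (order c f) - 2 * int (order c C) + 1"
      using sub[OF that, of c] sub[OF \<open>C \<noteq> 0\<close>, of c] \<beta>nz sub\<beta> by (simp add: fls_divide_subdegree)
    moreover have "order c f = 0 \<or> order c f = 1" using squarefree_f by (simp add: rsquarefree_def)
    moreover have "order c (B * f) = order c B + order c f" using that f_nz by (simp add: order_mult)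
    ultimately show ?thesis using b by linarith
  qed
qed


text \<open>The finite branches leave \<open>h = A' + N/v\<close> with polynomials \<open>A'\<close>
  and \<open>N\<close>. On the branch \<open>t = 1/s^2\<close>, where \<open>v\<close> has order -6
  and \<open>dt\<close> order -3, the two summands have orders \<open>- 2 deg A' - 3\<close> and
  \<open>3 - 2 deg N\<close>. The first is always negative, so \<open>A' = 0\<close>, and the second
  bounds the degree of \<open>N\<close> by 1.\<close>

lemma regular_form_cases:
  assumes "\<omega> \<in> regular_forms F"
  obtains p where "degree p \<le> 1" "\<omega> = form_du (pev p u / v)"
proof -
  have "\<omega> \<in> diff_forms F F" using assms by (simp add: regular_forms_def)
  then obtain n :: nat and a b where ab: "\<forall>i<n. a i \<in> F \<and> b i \<in> F"
    "\<omega> = form_du (\<Sum>i<n. a i * deriv_u (b i))"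
    unfolding diff_forms_conv[OF subset_refl] by blast
  define h where "h = (\<Sum>i<n. a i * deriv_u (b i))"
  have "(\<Sum>i<m. a i * deriv_u (b i)) \<in> F" if "m \<le> n" for m
    using that by (induction m) (use ab(1) in \<open>auto simp: generated_field_intros deriv_u_F\<close>)
  then have "h \<in> F" by (simp add: h_def)
  then obtain A B C where C: "C \<noteq> 0" and h: "h = (pev A u + pev B u * v) / pev C u"
    by (rule F_elem)
  have reg: "form_du h \<in> regular_forms F" using assms ab(2) by (simp add: h_def)
  have "C dvd A" using order_le_imp_dvd[OF C, of A] regular_form_order(1)[OF reg h C]
    by (cases "A = 0") auto
  then obtain A' where A': "A = C * A'" by blast
  have "C dvd B * f" using order_le_imp_dvd[OF C, of "B * f"] regular_form_order(2)[OF reg h C] f_nz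
    by (cases "B = 0") auto
  then obtain N where N: "B * f = C * N" by blast
  have B: "pev B w * v' = pev C w * pev N w / v'" if "hyperelliptic f w v'" for w v'
  proof -
    interpret h': hyperelliptic f w v' by fact
    have "pev B w * pev f w = pev C w * pev N w" using N by (metis fls.ev_mult)
    then have "pev B w * v' * v' = pev C w * pev N w"
      by (simp add: power2_eq_square mult.assoc flip: h'.curve)
    then show ?thesis using h'.v_nz by (simp add: field_simps)
  qed
  let ?\<alpha> = "fls_X_inv\<^sup>2 :: complex fls"
  note sub = pev_infinity_subdegree
  obtain \<beta> where \<beta>: "\<beta>\<^sup>2 = pev f ?\<alpha>"
    using fls_sqrt_exists[of "pev f ?\<alpha>"] sub[OF f_nz] by auto
  have \<beta>nz: "\<beta> \<noteq> 0" using \<beta> sub[OF f_nz] by auto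
  have "fls_subdegree (\<beta>\<^sup>2) = 2 * fls_subdegree \<beta>" using \<beta>nz by (simp add: power2_eq_square)
  then have sub\<beta>: "fls_subdegree \<beta> = - 6" using \<beta> sub[OF f_nz] degree_f by simp
  have sub\<alpha>: "fls_subdegree ?\<alpha> = -2" by (simp add: power2_eq_square)
  have nc: "?\<alpha> \<notin> range fls_const"
  proof
    assume "?\<alpha> \<in> range fls_const"
    then obtain c where "?\<alpha> = fls_const c" by blast
    then show False using sub\<alpha> by simp
  qed
  have pole: "?\<alpha> \<in> generated_field ?\<alpha> w" for w by (rule generated_field_gen1)
  have pole': "fls_subdegree ?\<alpha> < 0" by (simp add: sub\<alpha>)
  have sub': "fls_subdegree (fls_deriv ?\<alpha>) = -3"
    by (subst fls_deriv_subdegree') (simp_all add: sub\<alpha>)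
  then have d_nz: "fls_deriv ?\<alpha> \<noteq> 0" by auto
  let ?a = "pev A' ?\<alpha> * fls_deriv ?\<alpha>" and ?b = "pev N ?\<alpha> / \<beta> * fls_deriv ?\<alpha>"
  have C\<alpha>: "pev C ?\<alpha> \<noteq> 0" using sub[OF C] by blast
  have "(pev A ?\<alpha> + pev B ?\<alpha> * \<beta>) / pev C ?\<alpha> * fls_deriv ?\<alpha> = ?a + ?b"
    unfolding B[OF hyperelliptic_branch(1)[OF nc \<beta>]] A' fls.ev_mult using C\<alpha>
    by (simp add: add_divide_distrib distrib_right)
  then have plus: "0 \<le> fls_subdegree (?a + ?b)"
    using regular_form_along_branch[OF reg hyperelliptic_branch(1)[OF nc \<beta>] pole pole' h] by simp
  have "(pev A ?\<alpha> + pev B ?\<alpha> * (- \<beta>)) / pev C ?\<alpha> * fls_deriv ?\<alpha> = ?a + - ?b"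
    unfolding B[OF hyperelliptic_branch(2)[OF nc \<beta>]] A' fls.ev_mult using C\<alpha>
    by (simp add: add_divide_distrib diff_divide_distrib algebra_simps)
  then have minus: "0 \<le> fls_subdegree (?a + - ?b)"
    using regular_form_along_branch[OF reg hyperelliptic_branch(2)[OF nc \<beta>] pole pole' h] by simp
  have "(?a + ?b) + (?a + - ?b) = ?a + ?a" by simp
  then have a: "0 \<le> fls_subdegree ?a"
    using fls_regular_add[OF plus minus] fls_regular_half by metis
  have "(?a + ?b) + - (?a + - ?b) = ?b + ?b" by simp
  moreover have "0 \<le> fls_subdegree (- (?a + - ?b))" using minus by (simp only: fls_uminus_subdegree)
  ultimately have b: "0 \<le> fls_subdegree ?b"
    using fls_regular_add[OF plus] fls_regular_half by metis
  have "A' = 0"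
  proof (rule ccontr)
    assume "A' \<noteq> 0"
    then have "fls_subdegree ?a = - 2 * int (degree A') - 3" using sub[of A'] sub' d_nz by simp
    then show False using a by simp
  qed
  moreover have "degree N \<le> 1"
  proof (cases "N = 0")
    case False
    then have "fls_subdegree ?b = - 2 * int (degree N) + 6 - 3"
      using sub[of N] sub' d_nz \<beta>nz sub\<beta> by (simp add: fls_divide_subdegree)
    then show ?thesis using b by simp
  qed simp
  moreover have "h = pev A' u + pev N u / v"
    unfolding h B[OF hyperelliptic_axioms] A' using C by (simp add: add_divide_distrib)
  ultimately show ?thesis using that[of N] ab(2) by (simp add: h_def)
qed

section \<open>Lower bound: regularity at every place\<close>

lemma coprime_pderiv_bezout:
  obtains \<alpha> \<beta> where "\<alpha> * f + \<beta> * pderiv f = 1"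
proof -
  have "\<not> (poly f z = 0 \<and> poly (pderiv f) z = 0)" for z
    using squarefree_f rsquarefree_roots by blast
  then show ?thesis using poly_bezout[OF f_nz] that by blast
qed

lemma form_regular:
  assumes "degree p \<le> 1"
  shows "form_du (pev p u / v) \<in> regular_forms F"
proof -
  have "form_du (pev p u / v) \<in> diff_forms F F"
    unfolding diff_forms_conv[OF subset_refl]
    by (intro exI[of _ 1] exI[of _ "\<lambda>_. pev p u / v"] exI[of _ "\<lambda>_. u"])
      (simp add: generated_field_intros)
  moreover have "form_du (pev p u / v) \<in> diff_forms F V" if "is_place F V" for V
  proof -
    have VF: "V \<subseteq> F" and const: "fls_const c \<in> V" and ring: "x \<in> V \<Longrightarrow> y \<in> V \<Longrightarrow> x + y \<in> V \<and> x * y \<in> V"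
      and val: "x \<in> F \<Longrightarrow> x \<in> V \<or> inverse x \<in> V" for c x y
      using that by (auto simp: is_place_def)
    have pev: "pev q x \<in> V" if "x \<in> V" for q x
      by (rule pev_in_closed) (use const ring that in auto)
    have uminus: "- x \<in> V" if "x \<in> V" for x
      using ring[OF const[of "-1"] that] by (simp add: fls.hom_uminus)
    \<comment> \<open>An instance of the integral closedness of valuation rings: \<open>w\<close> is
      \<open>w^2\<close> times its inverse.\<close>
    have root: "w \<in> V" if "w \<in> F" "w\<^sup>2 \<in> V" for w
    proof (rule ccontr)
      assume "w \<notin> V"
      then have "inverse w \<in> V" using val[OF that(1)] by blast
      then have "w\<^sup>2 * inverse w \<in> V" using ring that(2) by blast
      then show False using \<open>w \<notin> V\<close> by (cases "w = 0") (auto simp: power2_eq_square mult.assoc)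
    qed
    show ?thesis
    proof (cases "u \<in> V")
      case True
      have v: "v \<in> V" by (rule root) (simp_all add: generated_field_intros curve pev True)
      \<comment> \<open>Since \<open>2 v dv = f'(u) du\<close>, the Bezout relation gives
        \<open>du/v = \<alpha> v du + 2 \<beta> dv\<close>, which is free of denominators.\<close>
      obtain \<alpha> \<beta> where *: "\<alpha> * f + \<beta> * pderiv f = 1" by (rule coprime_pderiv_bezout)
      have "pev \<alpha> u * v\<^sup>2 + pev \<beta> u * pev (pderiv f) u = 1"
        using arg_cong[OF *, of "\<lambda>p. pev p u"] by (simp add: curve)
      then have "1 / v = pev \<alpha> u * v + 2 * pev \<beta> u * deriv_u v"
        using v_nz by (simp add: deriv_u_v field_simps power2_eq_square)
      then have eq: "pev p u / v = pev p u * pev \<alpha> u * v * deriv_u u + pev p u * (2 * pev \<beta> u) * deriv_u v"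
        by (simp add: algebra_simps divide_inverse)
      show ?thesis
        unfolding diff_forms_conv[OF VF]
      proof (intro exI conjI allI impI)
        show "form_du (pev p u / v) = form_du (\<Sum>i<(2::nat). (if i = 0 then pev p u * pev \<alpha> u * v else pev p u * (2 * pev \<beta> u)) *
          deriv_u (if i = 0 then u else v))"
          unfolding eq by (simp add: numeral_2_eq_2 lessThan_Suc add.commute)
        fix i :: nat
        show "(if i = 0 then pev p u * pev \<alpha> u * v else pev p u * (2 * pev \<beta> u)) \<in> V"
          using ring pev[OF True] v const[of 2] by simp
        show "(if i = 0 then u else v) \<in> V" using v True by simp
      qed
    next
      case False
      text \<open>At a place over infinity, \<open>s = 1/u\<close> and \<open>w = v/u\<^sup>3\<close> are the regular coordinates.\<close>
      define s where "s = inverse u"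
      define w where "w = v * s ^ 3"
      have u_nz: "u \<noteq> 0" using nonconst fls_const_0 by (metis rangeI)
      have s: "s \<in> V" using val[of u] False by (simp add: s_def generated_field_intros)
      have s_nz: "s \<noteq> 0" using u_nz by (simp add: s_def)
      have sF: "s \<in> F" by (simp add: s_def generated_field_intros)
      have refl: "x ^ degree q * pev q (inverse x) = pev (reflect_poly q) x" if "x \<noteq> 0" for x q
        using that by (simp add: fls.ev_def map_poly_reflect_poly poly_reflect_poly_nz degree_map_poly)
      let ?y = "pev (reflect_poly f) s"
      have w2: "w\<^sup>2 = ?y"
        using refl[OF s_nz, of f] by (simp add: w_def power_mult_distrib curve degree_f s_def mult.commute flip: power_mult)
      have "w \<in> F" by (simp add: w_def generated_field_intros sF)
      then have w: "w \<in> V" by (rule root) (simp add: w2 pev s)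
      have w_nz: "w \<noteq> 0" using v_nz s_nz by (simp add: w_def)
      define l where "l = lead_coeff f"
      have l: "l \<noteq> 0" using f_nz by (simp add: l_def)
      obtain r where r: "reflect_poly f = pCons l r"
        by (metis coeff_0_reflect_poly l_def pCons_cases coeff_pCons_0)
      have y: "?y = fls_const l + s * pev r s" by (simp add: r)
      have y_nz: "?y \<noteq> 0" using w2 w_nz by auto
      have yF: "?y \<in> F" by (rule subsetD[OF VF pev[OF s]])
      \<comment> \<open>That \<open>?y\<close> is a unit follows from \<open>u\<close> lying outside
        \<open>V\<close>: if \<open>?y / s = l u + r(s)\<close> were in \<open>V\<close>, so would
        be \<open>u\<close>. Once \<open>s / ?y\<close> is in \<open>V\<close>, dividing
        \<open>?y = l + s r(s)\<close> by \<open>?y\<close> gives the inverse.\<close>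
      have "s / ?y \<in> V"
      proof (rule ccontr)
        assume "s / ?y \<notin> V"
        then have "inverse (s / ?y) \<in> V"
          using val[of "s / ?y"] sF yF by (auto simp: generated_field_intros)
        then have "?y * u \<in> V" by (simp add: s_def divide_inverse mult.commute)
        moreover have "?y * u = fls_const l * u + pev r s * (s * u)" unfolding y by (simp add: algebra_simps)
        then have "?y * u = fls_const l * u + pev r s" using u_nz by (simp add: s_def)
        ultimately have "fls_const l * u + pev r s + - pev r s \<in> V"
          using ring uminus pev[OF s] by metis
        then have "fls_const (1 / l) * (fls_const l * u) \<in> V" using ring const by simp
        moreover have "fls_const (1 / l) * (fls_const l * u) = u"
          using l by (simp flip: mult.assoc)
        ultimately show False using False by simp
      qed
      then have "fls_const (1 / l) * (1 + - (pev r s * (s / ?y))) \<in> V"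
        using const[of 1] const[of "1 / l"] pev[OF s]
        by (intro ring[THEN conjunct1] ring[THEN conjunct2] uminus) simp_all
      moreover have "fls_const (1 / l) * (1 + - (pev r s * (s / ?y))) = inverse ?y"
      proof -
        have "1 + - (pev r s * (s / ?y)) = (?y - s * pev r s) / ?y"
          using y_nz by (simp add: field_simps)
        also have "\<dots> = fls_const l / ?y" by (simp add: y)
        finally show ?thesis using l by (simp add: field_class.field_divide_inverse flip: mult.assoc)
      qed
      ultimately have inv_y: "inverse ?y \<in> V" by simp
      have "inverse w = w * inverse ?y"
        using w_nz by (simp flip: w2 add: power2_eq_square)
      then have inv_w: "inverse w \<in> V" using ring w inv_y by simp
      obtain p0 p1 where p: "p = [:p0, p1:]" using assms
        by (metis One_nat_def degree_eq_zeroE degree_pCons_eq_if le_Suc_eq le_zero_eq nat.inject pCons_0_0 pCons_cases)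
      have "deriv_u (s * u) = 0" using u_nz deriv_u_const[of 1] by (simp add: s_def)
      then have "deriv_u s * u + s = 0" by (simp add: deriv_u_mult)
      then have "deriv_u s * u = - s" by (simp add: eq_neg_iff_add_eq_0)
      moreover have "deriv_u s = deriv_u s * u * s" using u_nz by (simp add: s_def)
      ultimately have ds: "deriv_u s = - (s * s)" by simp
      have v: "v = w / s ^ 3" using s_nz by (simp add: w_def)
      \<comment> \<open>Here \<open>du = - ds/s^2\<close> and \<open>1/v = s^3/w\<close>; the one
        remaining factor \<open>s\<close> absorbs the pole of \<open>p0 + p1 u\<close>, which is
        where the degree bound enters.\<close>
      have "pev p u / v = - ((fls_const p0 * s + fls_const p1) * inverse w) * deriv_u s"
        unfolding v ds p using s_nz w_nz u_nz
        by (simp add: s_def field_simps power3_eq_cube)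
      moreover have "- ((fls_const p0 * s + fls_const p1) * inverse w) \<in> V"
        using ring const s inv_w uminus by simp
      ultimately show ?thesis
        unfolding diff_forms_conv[OF VF] using s
        by (intro exI[of _ 1] exI[of _ "\<lambda>_. - ((fls_const p0 * s + fls_const p1) * inverse w)"]
            exI[of _ "\<lambda>_. s"]) simp
    qed
  qed
  ultimately show ?thesis by (simp add: regular_forms_def)
qed

lemma function_field_genus_eq_2: "function_field_genus F = 2"
proof -
  interpret vs: vector_space scale_form by (rule vector_space_scale_form)
  let ?x = "form_du (1 / v)" and ?y = "form_du (u / v)"
  have scale: "scale_form c (form_du h) = form_du (fls_const c * h)" for c h
    by (auto simp: scale_form_def form_du_def)
  have add: "form_du h + form_du h' = form_du (h + h')" for h h'
    by (auto simp: form_du_def fun_eq_iff distrib_right)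
  have zero: "form_du 0 = 0" by (auto simp: form_du_def)
  have x: "?x \<noteq> 0" using form_du_inject[of "1 / v" 0] v_nz by (simp add: zero)
  have "?y \<notin> vs.span {?x}"
  proof
    assume "?y \<in> vs.span {?x}"
    then obtain c where "?y = scale_form c ?x" by (auto simp: vs.span_singleton)
    then have "u / v = fls_const c * (1 / v)" by (simp add: scale form_du_inject)
    then have "u = fls_const c" using v_nz by simp
    then show False using nonconst by simp
  qed
  moreover from this have "?y \<noteq> ?x" using vs.span_base by blast
  ultimately have "vs.independent {?y, ?x}" "card {?y, ?x} = 2"
    using x by (simp_all add: vs.independent_insert)
  moreover have "{?y, ?x} \<subseteq> regular_forms F"
    using form_regular[of "[:0, 1:]"] form_regular[of 1] by simp
  moreover have "regular_forms F \<subseteq> vs.span {?y, ?x}"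
  proof
    fix \<omega> assume "\<omega> \<in> regular_forms F"
    then obtain p where p: "degree p \<le> 1" "\<omega> = form_du (pev p u / v)" by (rule regular_form_cases)
    obtain p0 p1 where "p = [:p0, p1:]" using p(1)
      by (metis One_nat_def degree_eq_zeroE degree_pCons_eq_if le_Suc_eq le_zero_eq nat.inject pCons_0_0 pCons_cases)
    then have "\<omega> = scale_form p0 ?x + scale_form p1 ?y"
      by (simp add: p(2) scale add form_du_inject add_divide_distrib)
    then show "\<omega> \<in> vs.span {?y, ?x}"
      by (simp add: vs.span_add vs.span_scale vs.span_base)
  qed
  ultimately show ?thesis unfolding function_field_genus_def by (intro vs.dim_unique)
qed

end


section \<open>The parametrisation\<close>

text \<open>
  In terms of \<open>k = q/13\<close>, \<open>r = p/64\<close> and \<open>d = 4 - 27k\<^sup>2/(3k\<^sup>2 - r)\<close> the curve is parametrised by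
  \<open>z = 2nv/f\<close>, \<open>y = 2kmv/f\<^sup>2\<close>, where \<open>v\<^sup>2 = df/(4k)\<close>. The identities below express that
  \<open>8kz\<^sup>2 + 1 = 9 A\<^sub>2 A\<^sub>4/f\<close>, \<open>L = -27 A\<^sub>4\<^sup>3/f\<^sup>2\<close>, \<open>S = 729 k A\<^sub>4\<^sup>4/f\<^sup>3\<close> and \<open>M = 729 k (d - 4) A\<^sub>4\<^sup>3/f\<^sup>3\<close>.
  They also invert the parametrisation: in the coordinates \<open>E = 8kz\<^sup>2 + 1\<close> and \<open>R = E\<^sup>3/L\<close> the quotient
  of the curve by the involution is a rational plane sextic, and \<open>t\<close> is the ratio of two cubics that
  generate the pencil of cubics with 17 fixed intersections with it.
\<close>

definition par_n :: "'a::idom \<Rightarrow> 'a \<Rightarrow> 'a" where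
  "par_n d t = 1 - 3*t + d*t^3"

definition par_f :: "'a::idom \<Rightarrow> 'a \<Rightarrow> 'a" where
  "par_f d t = d^3*t^6 - 15*d^2*t^4 + 20*d^2*t^3 - 45*d*t^2 + 12*d*t + 27 - 8*d"

definition par_m :: "'a::idom \<Rightarrow> 'a \<Rightarrow> 'a" where
  "par_m d t = 42*d^3*t^6 - d^4*t^9 - 378*d^2*t^5 + 378*d^2*t^4 - 264*d^2*t^3 + 216*d*t^3
     + 270*d*t^2 + 216*d*t - 1053*t - 64*d + 270"

definition par_A2 :: "'a::idom \<Rightarrow> 'a \<Rightarrow> 'a" where
  "par_A2 d t = d*t^2 - 1"

definition par_A4 :: "'a::idom \<Rightarrow> 'a \<Rightarrow> 'a" where
  "par_A4 d t = d^2*t^4 - 6*d*t^2 + 4*d*t - 3"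

lemmas par_defs = par_n_def par_f_def par_m_def par_A2_def par_A4_def

lemma par_E: "8*d*par_n d t^2 + par_f d t = 9 * par_A2 d t * par_A4 d t"
  unfolding par_defs by algebra

lemma par_L: "4*d*par_n d t*par_m d t - 24*d*par_n d t^2*par_f d t + par_f d t^2 = - 27 * par_A4 d t^3"
  unfolding par_defs by algebra

lemma par_S:
  "d*par_m d t^2 + 64*d^2*par_n d t^3*par_m d t - 8*d*par_n d t*par_m d t*par_f d t + 256*d^3*par_n d t^6
    - 256*d^2*par_n d t^4*par_f d t + 52*d*par_n d t^2*par_f d t^2 + 3*par_f d t^3 = 729 * par_A4 d t^4"
  unfolding par_defs by algebra

lemma par_M:
  "d*par_m d t^2 + 4*d^2*par_n d t^3*par_m d t - 2*d*par_n d t*par_m d t*par_f d t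
    + 8*d^2*par_n d t^4*par_f d t - 11*d*par_n d t^2*par_f d t^2 + 4*par_f d t^3
    = 729 * (d - 4) * par_A4 d t^3"
  unfolding par_defs by algebra

lemma par_D:
  "27*par_f d t^2 + 486*par_A2 d t^3*par_f d t + 54*par_A4 d t^3 + 1215*par_A2 d t^2*par_A4 d t^2
    - 2916*par_A2 d t^4*par_A4 d t + 1458*par_A2 d t^6 - 324*par_A2 d t*par_A4 d t*par_f d t
    = 1728*d^2*par_n d t^3"
  unfolding par_defs by algebra

lemma par_N:
  "54*par_A2 d t*par_A4 d t*par_f d t + 162*par_A2 d t^3*par_f d t + 27*par_A4 d t^3
    - 243*par_A2 d t^2*par_A4 d t^2 - 729*par_A2 d t^4*par_A4 d t + 729*par_A2 d t^6
    = t*(1728*d^2*par_n d t^3)"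
  unfolding par_defs by algebra

text \<open>A Bezout identity for \<open>par_f\<close> and its derivative, the last factor on the
  left; the constant on the right is nonzero for \<open>d \<noteq> 4\<close>.\<close>

lemma par_f_squarefree:
  "6*(- 10*d^2*t^4 - 5*d^2*t^3 + 90*d*t^2 - 55*d*t + 256 - 54*d) * par_f d t
    + (10*d^2*t^5 + 5*d^2*t^4 - 140*d*t^3 + 130*d*t^2 + (104*d - 606)*t + 25)
      * (6*d*(d^2*t^5 - 10*d*t^3 + 10*d*t^2 - 15*t + 2)) = 2592*(d - 4)^2"
  unfolding par_defs by algebra

text \<open>Ensures that the numerator of \<open>z = 2 n v / f\<close> cancels none of the six poles
  of \<open>z\<close>.\<close>

lemma par_f_n_coprime:
  "(- 6*d*t^2 - 3*d*t + 16 - d) * par_f d t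
    + (6*d^3*t^5 + 3*d^3*t^4 + d^2*(d - 88)*t^3 + 78*d^2*t^2 + 3*d*(15*d - 98)*t + d*(19*d - 61))
      * par_n d t = 27*(d - 4)^2"
  unfolding par_defs by algebra


section \<open>The invariant curve\<close>

lemma bconst_add: "bconst (x + y) = bconst x + bconst y"
  and bconst_mult: "bconst (x * y) = bconst x * bconst y"
  and bconst_numeral: "bconst (numeral n) = numeral n"
  and bconst_1: "bconst 1 = 1"
  and bconst_0: "bconst 0 = 0"
  by (simp_all add: bconst_def numeral_poly one_pCons)

lemma bconst_uminus: "bconst (- x) = - bconst (x :: 'a::comm_ring_1)"
  and bconst_diff: "bconst (x - y) = bconst x - bconst (y :: 'a::comm_ring_1)"
  by (simp_all add: bconst_def)

lemma bconst_power: "bconst (x ^ n) = bconst x ^ n"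
  by (induction n) (simp_all add: bconst_mult bconst_1)

lemmas bconst_hom = bconst_add bconst_mult bconst_numeral bconst_1 bconst_0 bconst_uminus bconst_diff
  bconst_power

text \<open>The cofactors of \<open>inv_L\<close>, \<open>inv_S\<close> and \<open>inv_M\<close> are \<open>4y + 4kz\<close>, \<open>6y\<close> and \<open>6y - 12kz\<close>,
  where \<open>k = q/13\<close>.\<close>

definition inv_L :: "'a::comm_ring_1 \<Rightarrow> 'a \<Rightarrow> 'a \<Rightarrow> 'a" where
  "inv_L k z y = 4*z*y - 24*k*z^2 + 1"

definition inv_S :: "'a::comm_ring_1 \<Rightarrow> 'a \<Rightarrow> 'a \<Rightarrow> 'a" where
  "inv_S k z y = y^2 + 64*k^2*z^3*y - 8*k*z*y + 256*k^4*z^6 - 256*k^3*z^4 + 52*k^2*z^2 + 3*k"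

definition inv_M :: "'a::comm_ring_1 \<Rightarrow> 'a \<Rightarrow> 'a \<Rightarrow> 'a" where
  "inv_M k z y = y^2 + 4*k^2*z^3*y - 2*k*z*y + 8*k^3*z^4 - 11*k^2*z^2 + 4*k"

definition inv_g :: "'a::comm_ring_1 \<Rightarrow> 'a \<Rightarrow> 'a \<Rightarrow> 'a \<Rightarrow> 'a" where
  "inv_g k r z y = inv_S k z y^3 - (3*k^2 - r) * inv_L k z y^3 * inv_M k z y"

lemma curve_g_conv: "curve_g p q = inv_g (bconst (q/13)) (bconst (p/64)) Z Y"
proof -
  define k r where "k = q/13" and "r = p/64"
  \<comment> \<open>In \<open>k\<close> and \<open>r\<close> all coefficients of the curve are
    integers, so \<open>bconst_hom\<close> leaves an identity with integer coefficients.\<close>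
  have q: "q = 13 * k" and p: "p = 64 * r" by (simp_all add: k_def r_def)
  have "curve_g (64 * r) (13 * k) = inv_g (bconst k) (bconst r) Z Y"
    unfolding curve_g_def inv_g_def inv_S_def inv_L_def inv_M_def
    by (simp add: power_mult_distrib bconst_hom) algebra
  then show ?thesis by (simp add: q p)
qed

section \<open>The derivation along the vector field\<close>

lemma partial_z_0: "partial_z 0 = 0"
  and partial_z_pCons: "partial_z (pCons c f) = pCons (pderiv c) (partial_z f)"
  by (simp_all add: partial_z_def map_poly_pCons)

lemma partial_z_add: "partial_z (f + g) = partial_z f + partial_z g"
proof (induction f arbitrary: g)
  case (pCons c f)
  show ?case by (cases g) (simp add: partial_z_pCons pderiv_add pCons.IH)
qed (simp add: partial_z_0)

lemma partial_z_smult: "partial_z (smult c g) = smult c (partial_z g) + smult (pderiv c) g"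
  by (induction g) (simp_all add: partial_z_0 partial_z_pCons pderiv_mult add.commute mult.commute)

lemma partial_z_mult: "partial_z (f * g) = partial_z f * g + f * partial_z g"
proof (induction f)
  case (pCons c f)
  then show ?case
    by (simp add: partial_z_pCons partial_z_add partial_z_smult algebra_simps)
qed (simp add: partial_z_0)

definition flow :: "'a::idom bipoly \<Rightarrow> 'a bipoly \<Rightarrow> 'a bipoly \<Rightarrow> 'a bipoly" where
  "flow P Q f = P * partial_z f + Q * partial_y f"

lemma flow_add: "flow P Q (f + g) = flow P Q f + flow P Q g"
  by (simp add: flow_def partial_z_add partial_y_def pderiv_add algebra_simps)

lemma flow_mult: "flow P Q (f * g) = flow P Q f * g + f * flow P Q g"
  by (simp add: flow_def partial_z_mult partial_y_def pderiv_mult algebra_simps)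

lemma flow_bconst: "flow P Q (bconst c) = 0"
  by (simp add: flow_def bconst_def partial_z_pCons partial_z_0 partial_y_def pderiv_pCons)

lemma flow_numeral: "flow P Q (numeral n) = 0"
  using flow_bconst[of P Q "numeral n"] by (simp add: bconst_numeral)

lemma flow_1: "flow P Q 1 = 0"
  using flow_bconst[of P Q 1] by (simp add: bconst_1)

lemma flow_diff: "flow P Q (f - g) = flow P Q f - flow P Q g"
  using flow_add[of P Q "f - g" g] by simp

lemma flow_power: "flow P Q (f ^ Suc n) = of_nat (Suc n) * f ^ n * flow P Q f"
  by (induction n) (simp_all add: flow_mult algebra_simps)

lemma smult_const_1: "smult [:1:] f = (f :: 'a::comm_semiring_1 bipoly)"
  using smult_1_left[of f] by (simp only: one_pCons)

lemma flow_Z: "flow P Q Z = P"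
  by (simp add: flow_def Z_def partial_z_pCons partial_z_0 partial_y_def pderiv_pCons smult_const_1)

lemma flow_Y: "flow P Q Y = Q"
  by (simp add: flow_def Y_def partial_z_pCons partial_z_0 partial_y_def pderiv_pCons smult_const_1
      pderiv_1)

lemma flow_numeral_power: "flow P Q (f ^ numeral n) = numeral n * f ^ pred_numeral n * flow P Q f"
  using flow_power[of P Q f "pred_numeral n"]
  by (simp only: numeral_eq_Suc[symmetric] of_nat_numeral)

lemma invariant_curve_curve_g: "invariant_curve sysP (sysQ q) (curve_g p q) (18 * Y)"
proof -
  define k r :: "real bipoly" where "k = bconst (q/13)" and "r = bconst (p/64)"
  let ?D = "flow sysP (sysQ q)"
  have "q = 13 * (q/13)" by simp
  then have Q: "sysQ q = 3 * Y^2 - 8*k*Z*Y - 24*k^2*Z^2 + 13*k"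
    by (simp add: sysQ_def k_def bconst_hom power_divide flip: bconst_numeral bconst_mult bconst_power)
  have k: "flow P Q k = 0" and r: "flow P Q r = 0" for P Q
    by (simp_all add: k_def r_def flow_bconst)
  note flow_simps = flow_add flow_diff flow_mult flow_numeral_power flow_numeral flow_1 flow_Z flow_Y k r
  have S: "?D (inv_S k Z Y) = 6 * Y * inv_S k Z Y"
    unfolding inv_S_def flow_simps Q sysP_def by simp algebra
  have L: "?D (inv_L k Z Y) = (4 * Y + 4 * k * Z) * inv_L k Z Y"
    unfolding inv_L_def flow_simps Q sysP_def by simp algebra
  have M: "?D (inv_M k Z Y) = (6 * Y - 12 * k * Z) * inv_M k Z Y"
    unfolding inv_M_def flow_simps Q sysP_def by simp algebra
  \<comment> \<open>Cofactors add under products: \<open>3 * 6y\<close> for \<open>S^3\<close> and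
    \<open>3 (4y + 4kz) + (6y - 12kz)\<close> for \<open>L^3 M\<close> are both
    \<open>18y\<close>.\<close>
  have "?D (inv_g k r Z Y) = 18 * Y * inv_g k r Z Y"
    unfolding inv_g_def flow_simps S L M by simp algebra
  then show ?thesis
    by (simp add: invariant_curve_def curve_g_conv k_def r_def flow_def)
qed


section \<open>Degrees\<close>

text \<open>Upper bounds pass to sums and products, so they can be obtained from \<open>L\<close>,
  \<open>S\<close> and \<open>M\<close> without expanding the curve.\<close>

definition tdeg_le :: "nat \<Rightarrow> 'a::comm_ring_1 bipoly \<Rightarrow> bool" where
  "tdeg_le n f \<longleftrightarrow> (\<forall>i j. coeff (coeff f j) i \<noteq> 0 \<longrightarrow> i + j \<le> n)"

lemma tdeg_le_mono: "tdeg_le m f \<Longrightarrow> m \<le> n \<Longrightarrow> tdeg_le n f"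
  unfolding tdeg_le_def by (meson order_trans)

lemma tdeg_le_add: "tdeg_le n f \<Longrightarrow> tdeg_le n g \<Longrightarrow> tdeg_le n (f + g)"
  unfolding tdeg_le_def by (metis add.right_neutral coeff_add)

lemma tdeg_le_diff: "tdeg_le n f \<Longrightarrow> tdeg_le n g \<Longrightarrow> tdeg_le n (f - g)"
  unfolding tdeg_le_def by (metis diff_zero coeff_diff)

lemma tdeg_le_mult:
  assumes "tdeg_le m f" "tdeg_le n g"
  shows "tdeg_le (m + n) (f * g)"
  unfolding tdeg_le_def
proof (intro allI impI)
  fix i j assume "coeff (coeff (f * g) j) i \<noteq> 0"
  then have "(\<Sum>b\<le>j. \<Sum>a\<le>i. coeff (coeff f b) a * coeff (coeff g (j - b)) (i - a)) \<noteq> 0"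
    by (simp add: coeff_mult coeff_sum)
  then obtain b where b: "b \<le> j"
    "(\<Sum>a\<le>i. coeff (coeff f b) a * coeff (coeff g (j - b)) (i - a)) \<noteq> 0"
    by (meson atMost_iff sum.not_neutral_contains_not_neutral)
  then obtain a where a: "a \<le> i" "coeff (coeff f b) a * coeff (coeff g (j - b)) (i - a) \<noteq> 0"
    by (meson atMost_iff sum.not_neutral_contains_not_neutral)
  then have "a + b \<le> m" "(i - a) + (j - b) \<le> n"
    using assms unfolding tdeg_le_def by (metis mult_zero_left mult_zero_right)+
  then show "i + j \<le> m + n" using a b by linarith
qed

lemma tdeg_le_bconst: "tdeg_le n (bconst c)"
  by (auto simp: tdeg_le_def bconst_def coeff_pCons split: nat.splits if_splits)

lemma tdeg_le_1: "tdeg_le n 1"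
  using tdeg_le_bconst[of n 1] by (simp add: bconst_1)

lemma tdeg_le_Z: "tdeg_le 1 Z" and tdeg_le_Y: "tdeg_le 1 Y"
  by (auto simp: tdeg_le_def Z_def Y_def coeff_pCons split: nat.splits if_splits)

lemma tdeg_le_power: "tdeg_le n f \<Longrightarrow> tdeg_le (k * n) (f ^ k)"
  by (induction k) (simp_all add: tdeg_le_1 tdeg_le_mult)

lemma total_degree_eqI:
  assumes "tdeg_le n f" "coeff (coeff f j) i \<noteq> 0" "i + j = n"
  shows "total_degree f = n"
proof -
  let ?S = "{i + j |i j. coeff (coeff f j) i \<noteq> 0}"
  have "?S \<subseteq> {..n}" using assms(1) by (auto simp: tdeg_le_def)
  moreover have "finite ?S" using calculation finite_atMost finite_subset by blast
  moreover have "n \<in> ?S" using assms(2,3) by blast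
  ultimately show ?thesis unfolding total_degree_def by (intro Max_eqI) auto
qed

lemma tdeg_le_total_degree: "tdeg_le n f \<Longrightarrow> total_degree f \<le> n"
proof -
  assume f: "tdeg_le n f"
  let ?S = "{i + j |i j. coeff (coeff f j) i \<noteq> 0}"
  have "?S \<subseteq> {..n}" using f by (auto simp: tdeg_le_def)
  moreover have "finite ?S" using calculation finite_atMost finite_subset by blast
  ultimately show ?thesis unfolding total_degree_def by (subst Max_le_iff) auto
qed

lemma tdeg_le_Z_Y:
  "tdeg_le n (bconst c * Z ^ i * Y ^ j)" if "i + j \<le> n"
proof -
  have "tdeg_le (0 + i * 1 + j * 1) (bconst c * Z ^ i * Y ^ j)"
    by (intro tdeg_le_mult tdeg_le_power tdeg_le_bconst tdeg_le_Z tdeg_le_Y)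
  then show ?thesis using tdeg_le_mono that by fastforce
qed

lemma quadratic_system: "quadratic_system sysP (sysQ q)"
proof -
  have "sysP = bconst 1 * Z ^ 1 * Y ^ 1 + (bconst 1 * Z ^ 0 * Y ^ 0 :: real bipoly)"
    by (simp add: sysP_def bconst_1)
  also have "tdeg_le 2 \<dots>" by (intro tdeg_le_add tdeg_le_Z_Y) auto
  finally have "tdeg_le 2 sysP" .
  then have "total_degree sysP = 2"
    by (rule total_degree_eqI[where i = 1 and j = 1]) (simp_all add: sysP_def Z_def Y_def one_pCons)
  moreover have "sysQ q = bconst 3 * Z ^ 0 * Y ^ 2 - bconst (8/13 * q) * Z ^ 1 * Y ^ 1
    - bconst (24/169 * q^2) * Z ^ 2 * Y ^ 0 + bconst q * Z ^ 0 * Y ^ 0"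
    by (simp add: sysQ_def bconst_numeral)
  then have "tdeg_le 2 (sysQ q)"
    by (simp only:) (intro tdeg_le_add tdeg_le_diff tdeg_le_Z_Y; simp)
  then have "total_degree (sysQ q) \<le> 2" by (rule tdeg_le_total_degree)
  ultimately show ?thesis by (simp add: quadratic_system_def)
qed

lemma const_power: "[:c:] ^ n = [:(c :: 'a::comm_ring_1) ^ n:]"
  by (induction n) (simp_all add: one_pCons)

text \<open>\<open>S^3\<close> has degree 18 and the other term at most 10. Setting
  \<open>y = 0\<close> exhibits the monomial \<open>z^18\<close>, with coefficient
  \<open>(256 k^4)^3\<close>.\<close>

lemma total_degree_curve_g:
  assumes "q \<noteq> 0"
  shows "total_degree (curve_g p q) = 18"
proof -
  define k where "k = q / 13"
  let ?k = "bconst k" and ?r = "bconst (p/64)" and ?x = "[:0, 1:] :: real poly"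
  have S: "inv_S ?k Z Y = bconst 1 * Z ^ 0 * Y ^ 2 + bconst (64*k^2) * Z ^ 3 * Y ^ 1
    - bconst (8*k) * Z ^ 1 * Y ^ 1 + bconst (256*k^4) * Z ^ 6 * Y ^ 0
    - bconst (256*k^3) * Z ^ 4 * Y ^ 0 + bconst (52*k^2) * Z ^ 2 * Y ^ 0 + bconst (3*k) * Z ^ 0 * Y ^ 0"
    by (simp add: inv_S_def bconst_hom)
  have "tdeg_le 6 (inv_S ?k Z Y)"
    unfolding S by (intro tdeg_le_add tdeg_le_diff tdeg_le_Z_Y; simp)
  then have S3: "tdeg_le 18 (inv_S ?k Z Y ^ 3)" using tdeg_le_power[of 6 _ 3] by simp
  have L: "inv_L ?k Z Y = bconst 4 * Z ^ 1 * Y ^ 1 - bconst (24*k) * Z ^ 2 * Y ^ 0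
    + bconst 1 * Z ^ 0 * Y ^ 0"
    by (simp add: inv_L_def bconst_hom)
  have "tdeg_le 2 (inv_L ?k Z Y)"
    unfolding L by (intro tdeg_le_add tdeg_le_diff tdeg_le_Z_Y; simp)
  then have L3: "tdeg_le 6 (inv_L ?k Z Y ^ 3)" using tdeg_le_power[of 2 _ 3] by simp
  have M: "inv_M ?k Z Y = bconst 1 * Z ^ 0 * Y ^ 2 + bconst (4*k^2) * Z ^ 3 * Y ^ 1
    - bconst (2*k) * Z ^ 1 * Y ^ 1 + bconst (8*k^3) * Z ^ 4 * Y ^ 0
    - bconst (11*k^2) * Z ^ 2 * Y ^ 0 + bconst (4*k) * Z ^ 0 * Y ^ 0"
    by (simp add: inv_M_def bconst_hom)
  have M4: "tdeg_le 4 (inv_M ?k Z Y)"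
    unfolding M by (intro tdeg_le_add tdeg_le_diff tdeg_le_Z_Y; simp)
  have "tdeg_le (0 + 6 + 4) ((3 * ?k^2 - ?r) * inv_L ?k Z Y ^ 3 * inv_M ?k Z Y)"
    using tdeg_le_bconst[of 0 "3 * k^2 - p/64"]
    unfolding bconst_diff bconst_mult bconst_numeral bconst_power
    by (rule tdeg_le_mult[OF tdeg_le_mult[OF _ L3] M4])
  then have le: "tdeg_le 18 (inv_g ?k ?r Z Y)"
    unfolding inv_g_def by (rule tdeg_le_diff[OF S3 tdeg_le_mono]) simp
  have x: "?x ^ n = monom 1 n" for n by (simp add: monom_altdef)
  have S0: "inv_S [:k:] ?x 0 = [:3*k, 0, 52*k^2, 0, -256*k^3, 0, 256*k^4:]"
    by (simp add: inv_S_def numeral_poly const_power numeral_eq_Suc)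
  have L0: "inv_L [:k:] ?x 0 = [:1, 0, -24*k:]"
    by (simp add: inv_L_def numeral_poly const_power numeral_eq_Suc one_pCons mult.commute)
  have M0: "inv_M [:k:] ?x 0 = [:4*k, 0, -11*k^2, 0, 8*k^3:]"
    by (simp add: inv_M_def numeral_poly const_power numeral_eq_Suc)
  have k: "k \<noteq> 0" using assms by (simp add: k_def)
  have degS: "degree (inv_S [:k:] ?x 0) = 6" by (simp add: S0 k)
  then have "coeff (inv_S [:k:] ?x 0 ^ 3) (3 * 6) = coeff (inv_S [:k:] ?x 0) 6 ^ 3"
    by (metis degree_power_eq degree_0 lead_coeff_power mult.commute zero_neq_numeral)
  then have cS: "coeff (inv_S [:k:] ?x 0 ^ 3) 18 \<noteq> 0" using k by (simp add: S0 numeral_eq_Suc)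
  have "degree (inv_L [:k:] ?x 0) \<le> 2" "degree (inv_M [:k:] ?x 0) \<le> 4" by (simp_all add: L0 M0)
  then have "degree ([:3*k^2 - p/64:] * inv_L [:k:] ?x 0 ^ 3 * inv_M [:k:] ?x 0) \<le> 0 + 2 * 3 + 4"
    by (intro degree_mult_le[THEN order_trans] add_mono degree_power_le[THEN order_trans]) auto
  then have cL: "coeff ([:3*k^2 - p/64:] * inv_L [:k:] ?x 0 ^ 3 * inv_M [:k:] ?x 0) 18 = 0"
    by (intro coeff_eq_0) linarith
  have "poly (inv_S ?k Z Y) 0 = inv_S [:k:] ?x 0" "poly (inv_L ?k Z Y) 0 = inv_L [:k:] ?x 0"
    "poly (inv_M ?k Z Y) 0 = inv_M [:k:] ?x 0"
    by (simp_all add: inv_S_def inv_L_def inv_M_def bconst_def Z_def Y_def)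
  then have c0: "coeff (inv_g ?k ?r Z Y) 0 =
      inv_S [:k:] ?x 0 ^ 3 - [:3*k^2 - p/64:] * inv_L [:k:] ?x 0 ^ 3 * inv_M [:k:] ?x 0"
    by (simp add: inv_g_def bconst_def const_power numeral_poly flip: poly_0_coeff_0)
  have "coeff (coeff (inv_g ?k ?r Z Y) 0) 18 \<noteq> 0"
    unfolding c0 coeff_diff cL using cS by simp
  then show ?thesis using le by (auto simp: curve_g_conv k_def intro: total_degree_eqI)
qed

section \<open>The complexified curve\<close>

interpretation rc: coeff_hom "\<lambda>x. fls_const (complex_of_real x)"
  by standard (simp_all add: fls_plus_const)

interpretation rcbi: coeff_hom "\<lambda>c. rc.ev c a" for a
  by standard simp_all

lemma complexify_0: "complexify 0 = 0"
  and complexify_pCons: "complexify (pCons c f) = pCons (map_poly complex_of_real c) (complexify f)"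
  by (simp_all add: complexify_def map_poly_pCons)

lemma pev_of_real: "pev (map_poly complex_of_real c) a = rc.ev c a"
  by (induction c) (simp_all add: map_poly_pCons)

lemma bieval_complexify: "bieval (complexify h) a b = rcbi.ev a h b"
  by (induction h) (simp_all add: complexify_0 complexify_pCons pev_of_real)

lemma rcbi_atoms: "rcbi.ev a (bconst c) b = fls_const (complex_of_real c)" "rcbi.ev a Z b = a"
  "rcbi.ev a Y b = b" "rcbi.ev a (numeral n) b = numeral n"
proof -
  show *: "rcbi.ev a (bconst c) b = fls_const (complex_of_real c)" for c by (simp add: bconst_def)
  show "rcbi.ev a (numeral n) b = numeral n" using *[of "numeral n"] by (simp add: bconst_numeral)
qed (simp_all add: Z_def Y_def)

lemma bieval_curve_g:
  "bieval (complexify (curve_g p q)) a b =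
    inv_g (fls_const (complex_of_real (q/13))) (fls_const (complex_of_real (p/64))) a b"
  unfolding bieval_complexify curve_g_conv inv_g_def inv_S_def inv_L_def inv_M_def
  by (simp only: rcbi.ev_add rcbi.ev_diff rcbi.ev_mult rcbi.ev_power rcbi.ev_1 rcbi_atoms)

text \<open>\<open>S\<close> is monic of degree 2 in \<open>y\<close>, and the term with
  \<open>L^3 M\<close> has degree at most 5 in \<open>y\<close>. Monicity permits division by the
  curve over the ring of polynomials in \<open>z\<close>.\<close>

lemma curve_g_monic:
  "degree (complexify (curve_g p q)) = 6" "lead_coeff (complexify (curve_g p q)) = 1"
proof -
  let ?k = "bconst (q/13)" and ?r = "bconst (p/64)"
  define c where "c = q / 13"
  let ?x = "[:0, 1:] :: real poly"
  have S: "inv_S (bconst c) Z Y = [:256*[:c:]^4*?x^6 - 256*[:c:]^3*?x^4 + 52*[:c:]^2*?x^2 + 3*[:c:],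
      64*[:c:]^2*?x^3 - 8*[:c:]*?x, 1:]"
    by (simp add: inv_S_def bconst_def Z_def Y_def numeral_poly const_power power2_eq_square one_pCons mult.commute)
  have M: "inv_M (bconst c) Z Y = [:8*[:c:]^3*?x^4 - 11*[:c:]^2*?x^2 + 4*[:c:],
      4*[:c:]^2*?x^3 - 2*[:c:]*?x, 1:]"
    by (simp add: inv_M_def bconst_def Z_def Y_def numeral_poly const_power power2_eq_square one_pCons mult.commute)
  have L: "inv_L (bconst c) Z Y = [:1 - 24*[:c:]*?x^2, 4 * ?x:]"
    by (simp add: inv_L_def bconst_def Z_def Y_def numeral_poly const_power power2_eq_square one_pCons mult.commute)
  have dS: "degree (inv_S ?k Z Y ^ 3) = 6" "coeff (inv_S ?k Z Y ^ 3) 6 = 1"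
  proof -
    have "degree (inv_S ?k Z Y) = 2" "lead_coeff (inv_S ?k Z Y) = 1"
      unfolding c_def[symmetric] S by simp_all
    moreover from this have "inv_S ?k Z Y \<noteq> 0" by auto
    ultimately show "degree (inv_S ?k Z Y ^ 3) = 6" by (simp add: degree_power_eq)
    moreover have "lead_coeff (inv_S ?k Z Y ^ 3) = 1"
      using \<open>lead_coeff (inv_S ?k Z Y) = 1\<close> by (simp add: lead_coeff_power)
    ultimately show "coeff (inv_S ?k Z Y ^ 3) 6 = 1" by simp
  qed
  have "degree (inv_L ?k Z Y) \<le> 1" "degree (inv_M ?k Z Y) \<le> 2"
    unfolding c_def[symmetric] L M by simp_all
  moreover have "degree (3 * ?k^2 - ?r) = 0"
    by (simp add: bconst_def numeral_poly const_power)
  ultimately have "degree ((3 * ?k^2 - ?r) * inv_L ?k Z Y ^ 3 * inv_M ?k Z Y) \<le> 0 + 1 * 3 + 2"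
    by (intro degree_mult_le[THEN order_trans] add_mono degree_power_le[THEN order_trans]) auto
  then have lt: "degree ((3 * ?k^2 - ?r) * inv_L ?k Z Y ^ 3 * inv_M ?k Z Y) < 6" by linarith
  then have "coeff (curve_g p q) 6 = 1" "degree (curve_g p q) \<le> 6"
    unfolding curve_g_conv inv_g_def using dS
    by (simp_all add: coeff_eq_0 degree_diff_le)
  then have deg: "degree (curve_g p q) = 6" by (metis antisym le_degree zero_neq_one)
  have "map_poly complex_of_real x \<noteq> 0" if "x \<noteq> 0" for x
    using that by (simp add: map_poly_eq_0_iff)
  then show "degree (complexify (curve_g p q)) = 6"
    unfolding complexify_def using deg by (simp add: degree_map_poly)
  then show "lead_coeff (complexify (curve_g p q)) = 1"
    using \<open>coeff (curve_g p q) 6 = 1\<close> by (simp add: complexify_def coeff_map_poly)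
qed


section \<open>Power series branches\<close>

lemma fps_compose_of_poly:
  assumes "fps_nth w 0 = 0"
  shows "fps_to_fls (fps_of_poly (p \<circ>\<^sub>p [:x, 1:]) oo w) = pev p (fls_const x + fps_to_fls w)"
proof (induction p)
  case (pCons a p)
  have "fps_of_poly ([:a:] + [:x, 1:] * (p \<circ>\<^sub>p [:x, 1:])) oo w =
    fps_const a + (fps_const x + w) * (fps_of_poly (p \<circ>\<^sub>p [:x, 1:]) oo w)"
    unfolding fps_of_poly_add fps_of_poly_mult fps_of_poly_const fps_of_poly_linear
      fps_compose_add_distrib fps_compose_mult_distrib[OF assms]
    using assms by (simp add: add.commute)
  then show ?case
    unfolding pcompose_pCons by (simp add: fls_times_fps_to_fls flip: pCons.IH)
qed simp

text \<open>Hensel's lemma, by inverting the power series \<open>P/N\<close>.\<close>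

lemma power_series_root:
  fixes P N :: "complex poly"
  assumes "poly P x = 0" "poly (pderiv P) x \<noteq> 0" "poly N x \<noteq> 0"
  obtains \<tau> where "fls_nth \<tau> 0 = x" "pev P \<tau> = fls_X\<^sup>2 * pev N \<tau>"
proof -
  let ?A = "fps_of_poly (P \<circ>\<^sub>p [:x, 1:])" and ?B = "fps_of_poly (N \<circ>\<^sub>p [:x, 1:])"
  have nth0: "fps_nth (fps_of_poly (p \<circ>\<^sub>p [:x, 1:])) 0 = poly p x" for p
    by (simp add: poly_pcompose flip: poly_0_coeff_0)
  have "coeff (P \<circ>\<^sub>p [:x, 1:]) 1 = coeff (pderiv (P \<circ>\<^sub>p [:x, 1:])) 0" by (simp add: coeff_pderiv)
  also have "\<dots> = poly (pderiv P) x"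
    by (simp add: pderiv_pcompose pderiv_pCons poly_pcompose flip: poly_0_coeff_0)
  finally have A1: "fps_nth ?A 1 = poly (pderiv P) x" by simp
  define \<Psi> where "\<Psi> = ?A * inverse ?B"
  have B: "fps_nth ?B 0 \<noteq> 0" using nth0 assms(3) by simp
  then have AB: "?A = \<Psi> * ?B" by (simp add: \<Psi>_def mult.assoc inverse_mult_eq_1)
  have \<Psi>0: "fps_nth \<Psi> 0 = 0" using nth0[of P] assms(1) by (simp add: \<Psi>_def)
  have "fps_nth ?A 1 = fps_nth \<Psi> 1 * fps_nth ?B 0"
    by (subst AB) (simp add: fps_mult_nth \<Psi>0)
  then have \<Psi>1: "fps_nth \<Psi> 1 \<noteq> 0" using A1 assms(2) by auto
  \<comment> \<open>Substituting \<open>X^2\<close> into the compositional inverse solves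
    \<open>\<Psi>(w) = X^2\<close>, that is, \<open>P = X^2 N\<close> at
    \<open>x + w\<close>.\<close>
  define w where "w = fps_inv \<Psi> oo fps_X\<^sup>2"
  have inv0: "fps_nth (fps_inv \<Psi>) 0 = 0" by (simp add: fps_inv_def)
  then have w0: "fps_nth w 0 = 0" by (simp add: w_def)
  have X2: "fps_nth (fps_X\<^sup>2) 0 = (0 :: complex)" by simp
  have comp: "F oo w = (F oo fps_inv \<Psi>) oo fps_X\<^sup>2" for F
    unfolding w_def by (rule fps_compose_assoc) (simp_all add: inv0)
  have "\<Psi> oo w = fps_X\<^sup>2"
    by (simp add: comp fps_inv_right[OF \<Psi>0 \<Psi>1] fps_X_fps_compose_startby0[OF X2])
  then have "?A oo w = fps_X\<^sup>2 * (?B oo w)"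
    by (subst AB) (simp add: fps_compose_mult_distrib[OF w0])
  then have "pev P (fls_const x + fps_to_fls w) = fls_X\<^sup>2 * pev N (fls_const x + fps_to_fls w)"
    unfolding fps_compose_of_poly[OF w0, symmetric]
    by (simp add: fls_times_fps_to_fls fps_to_fls_power)
  moreover have "fls_nth (fls_const x + fps_to_fls w) 0 = x" by (simp add: w0)
  ultimately show ?thesis using that by blast
qed

lemma pev_const: "pev p (fls_const x) = fls_const (poly p x)"
  by (induction p) (simp_all add: fls_plus_const)

lemma card_roots_rsquarefree:
  fixes p :: "complex poly"
  assumes "rsquarefree p"
  shows "card {z. poly p z = 0} = degree p"
proof -
  have nz: "p \<noteq> 0" using assms by (simp add: rsquarefree_def)
  have "degree (\<Prod>z | poly p z = 0. [:- z, 1:]) = (\<Sum>z | poly p z = 0. degree [:- z, 1:])"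
    by (rule degree_prod_eq_sum_degree) auto
  then have "degree (smult (lead_coeff p) (\<Prod>z | poly p z = 0. [:- z, 1:])) = card {z. poly p z = 0}"
    using nz by simp
  then show ?thesis by (simp only: complex_poly_decompose_rsquarefree[OF assms])
qed


section \<open>Branches at infinity and generic points\<close>

text \<open>By \<open>r_eq\<close> and \<open>k_nz\<close> also \<open>3 k^2 - r\<close> is nonzero;
  together with \<open>d_nz\<close> this excludes both exceptional values of
  \<open>p\<close>.\<close>

locale curve_parameters =
  fixes k d r :: complex
  assumes k_nz: "k \<noteq> 0" and d_nz: "d \<noteq> 0" and d_neq_4: "d \<noteq> 4"
    and r_eq: "(3*k^2 - r) * (4 - d) = 27*k^2"
begin

definition fpol :: "complex poly" where
  "fpol = [:27 - 8*d, 12*d, -45*d, 20*d^2, -15*d^2, 0, d^3:]"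

definition npol :: "complex poly" where
  "npol = [:1, -3, 0, d:]"

lemma poly_fpol: "poly fpol x = par_f d x"
  by (simp add: fpol_def par_f_def) algebra

lemma poly_npol: "poly npol x = par_n d x"
  by (simp add: npol_def par_n_def) algebra

abbreviation "dc \<equiv> fls_const d"
abbreviation "kc \<equiv> fls_const k"

lemma pev_fpol: "pev fpol t = par_f dc t"
  by (simp add: fpol_def par_f_def fls.hom_add fls.hom_mult fls.hom_uminus fls_const_power
      flip: fls_plus_const fls_const_mult_const fls_minus_const) algebra

lemma pev_npol: "pev npol t = par_n dc t"
  by (simp add: npol_def par_n_def fls.hom_uminus) algebra

lemma pev_A4: "pev [:-3, 4*d, -6*d, 0, d^2:] t = par_A4 dc t"
  by (simp add: par_A4_def fls.hom_uminus fls_const_power flip: fls_const_mult_const) algebra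

definition hpol :: "complex poly" where
  "hpol = smult (d / (4*k)) fpol"

lemma fpol_simple_roots:
  assumes "poly fpol x = 0"
  shows "poly (pderiv fpol) x \<noteq> 0"
proof
  assume "poly (pderiv fpol) x = 0"
  then have G: "6*d*(d^2*x^5 - 10*d*x^3 + 10*d*x^2 - 15*x + 2) = 0"
    by (simp add: fpol_def pderiv_pCons) algebra
  have "2592*(d - 4)^2 = 0"
    using par_f_squarefree[of d x] assms
    unfolding poly_fpol G by (simp only: mult_zero_right add_0_left)
  then show False using d_neq_4 by simp
qed

lemma npol_nz_at_root:
  assumes "poly fpol x = 0"
  shows "poly npol x \<noteq> 0"
proof
  assume "poly npol x = 0"
  then have "27*(d - 4)^2 = 0"
    using par_f_n_coprime[of d x] assms
    unfolding poly_fpol poly_npol by (simp only: mult_zero_right add_0_left)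
  then show False using d_neq_4 by simp
qed

lemma degree_fpol: "degree fpol = 6"
  using d_nz by (simp add: fpol_def)

lemma rsquarefree_fpol: "rsquarefree fpol"
  using fpol_simple_roots by (auto simp: rsquarefree_roots)

lemma degree_hpol: "degree hpol = 6"
  using d_nz k_nz by (simp add: hpol_def degree_fpol)

lemma rsquarefree_hpol: "rsquarefree hpol"
  using fpol_simple_roots d_nz k_nz by (auto simp: rsquarefree_roots hpol_def pderiv_smult)

definition zpar :: "complex fls \<Rightarrow> complex fls \<Rightarrow> complex fls" where
  "zpar t v = 2 * par_n dc t * v / par_f dc t"

definition ypar :: "complex fls \<Rightarrow> complex fls \<Rightarrow> complex fls" where
  "ypar t v = 2 * kc * par_m dc t * v / par_f dc t ^ 2"

lemma
  assumes "hyperelliptic hpol t v"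
  shows curve_par: "inv_g kc (fls_const r) (zpar t v) (ypar t v) = 0"
    and generated_field_par: "generated_field (zpar t v) (ypar t v) = generated_field t v"
proof -
  interpret hyperelliptic hpol t v by fact
  define F n m A2 A4 where "F = par_f dc t" and "n = par_n dc t" and "m = par_m dc t"
    and "A2 = par_A2 dc t" and "A4 = par_A4 dc t"
  note ids = par_E[of dc t, folded F_def n_def m_def A2_def A4_def]
    par_L[of dc t, folded F_def n_def m_def A2_def A4_def]
    par_S[of dc t, folded F_def n_def m_def A2_def A4_def]
    par_M[of dc t, folded F_def n_def m_def A2_def A4_def]
    par_D[of dc t, folded F_def n_def m_def A2_def A4_def]
    par_N[of dc t, folded F_def n_def m_def A2_def A4_def]
  define z y where "z = zpar t v" and "y = ypar t v"
  have kc: "kc \<noteq> 0" and dc: "dc \<noteq> 0" using k_nz d_nz by simp_all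
  have "fls_const (4*k) * v^2 = fls_const (4*k) * (fls_const (d/(4*k)) * F)"
    by (simp add: curve hpol_def pev_fpol F_def)
  also have "\<dots> = dc * F" using k_nz by (simp flip: mult.assoc)
  finally have v2: "4 * kc * v^2 = dc * F" by (simp flip: fls_const_mult_const)
  have F: "F \<noteq> 0" using v2 v_nz kc by auto
  have "npol \<noteq> 0" by (simp add: npol_def)
  then have n: "n \<noteq> 0" using pev_u_eq_0_iff[of npol] by (simp add: pev_npol n_def)
  have "pev [:-3, 4*d, -6*d, 0, d^2:] t \<noteq> 0" unfolding pev_u_eq_0_iff by simp
  then have A4: "A4 \<noteq> 0" unfolding pev_A4 A4_def .
  have zF: "z * F = 2 * n * v" and yF: "y * F^2 = 2 * kc * m * v"
    using F by (simp_all add: z_def y_def zpar_def ypar_def F_def n_def m_def)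
  \<comment> \<open>\<open>L\<close>, \<open>S\<close> and \<open>M\<close> are invariant under
    \<open>(z, y) \<mapsto> (-z, -y)\<close>, so they only involve \<open>z^2\<close>,
    \<open>z y\<close> and \<open>y^2\<close>. In these \<open>v\<close> occurs squared, and all
    three become rational in \<open>t\<close>.\<close>
  have "(kc * z^2 * F) * F = n^2 * (4 * kc * v^2)"
    using zF by algebra
  also have "\<dots> = (dc * n^2) * F" unfolding v2 by algebra
  finally have h1: "kc * z^2 * F = dc * n^2" using F by simp
  have "(z * y * F^2) * F = n * m * (4 * kc * v^2)" using zF yF by algebra
  also have "\<dots> = (dc * n * m) * F" unfolding v2 by algebra
  finally have h2: "z * y * F^2 = dc * n * m" using F by simp
  have "(y^2 * F^3) * F = kc * m^2 * (4 * kc * v^2)" using yF by algebra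
  also have "\<dots> = (kc * dc * m^2) * F" unfolding v2 by algebra
  finally have h3: "y^2 * F^3 = kc * dc * m^2" using F by simp
  have E: "(8*kc*z^2 + 1) * F = 9 * A2 * A4" using h1 ids(1) by algebra
  have L: "inv_L kc z y * F^2 = - 27 * A4^3"
  proof -
    have "inv_L kc z y * F^2 = 4 * (z*y*F^2) - 24 * (kc*z^2*F) * F + F^2"
      unfolding inv_L_def by algebra
    then show ?thesis unfolding h1 h2 using ids(2) by algebra
  qed
  have S: "inv_S kc z y * F^3 = 729 * kc * A4^4"
  proof -
    have "inv_S kc z y * F^3 = y^2*F^3 + 64*kc*(kc*z^2*F)*(z*y*F^2) - 8*kc*(z*y*F^2)*F
      + 256*kc*(kc*z^2*F)^3 - 256*kc*(kc*z^2*F)^2*F + 52*kc*(kc*z^2*F)*F^2 + 3*kc*F^3"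
      unfolding inv_S_def by algebra
    also have "\<dots> = kc * (729 * A4^4)" unfolding h1 h2 h3 ids(3)[symmetric] by algebra
    finally show ?thesis by simp
  qed
  have M: "inv_M kc z y * F^3 = 729 * kc * (dc - 4) * A4^3"
  proof -
    have "inv_M kc z y * F^3 = y^2*F^3 + 4*kc*(kc*z^2*F)*(z*y*F^2) - 2*kc*(z*y*F^2)*F
      + 8*kc*(kc*z^2*F)^2*F - 11*kc*(kc*z^2*F)*F^2 + 4*kc*F^3"
      unfolding inv_M_def by algebra
    also have "\<dots> = kc * (729 * (dc - 4) * A4^3)" unfolding h1 h2 h3 ids(4)[symmetric] by algebra
    finally show ?thesis by simp
  qed
  have "fls_const ((3*k^2 - r) * (4 - d)) = fls_const (27*k^2)" by (simp only: r_eq)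
  then have req: "(3*kc^2 - fls_const r) * (4 - dc) = 27 * kc^2"
    by (simp add: fls_const_power flip: fls_const_mult_const fls_minus_const)
  have "inv_g kc (fls_const r) z y * F^9 = (inv_S kc z y * F^3)^3
    - (3*kc^2 - fls_const r) * (inv_L kc z y * F^2)^3 * (inv_M kc z y * F^3)"
    unfolding inv_g_def by algebra
  \<comment> \<open>The number is \<open>3^15\<close>, common to \<open>729^3\<close> and
    \<open>27^3 * 729\<close>; the last factor vanishes by the choice of \<open>d\<close>.\<close>
  also have "\<dots> = 14348907 * kc * A4^12 * (27 * kc^2 - (3*kc^2 - fls_const r) * (4 - dc))"
    unfolding L S M by algebra
  also have "\<dots> = 0" unfolding req by simp
  finally show "inv_g kc (fls_const r) (zpar t v) (ypar t v) = 0" using F by (simp add: z_def y_def)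
  have const: "kc \<in> generated_field a b" "dc \<in> generated_field a b" for a b
    by (simp_all add: generated_field_intros)
  have "z \<in> generated_field t v" "y \<in> generated_field t v"
    unfolding z_def y_def zpar_def ypar_def par_defs by (intro generated_field_intros)+
  then have "generated_field z y \<subseteq> generated_field t v" by (rule generated_field_subset)
  moreover have "t \<in> generated_field z y"
  proof -
    define E l R where "E = 8*kc*z^2 + 1" and "l = inv_L kc z y" and "R = E^3 / l"
    have l: "l * F^2 = - 27 * A4^3" using L by (simp add: l_def)
    then have l_nz: "l \<noteq> 0" using A4 by auto
    have E: "E * F = 9 * A2 * A4" using E by (simp add: E_def)
    have "R * l = E^3" using l_nz by (simp add: R_def)
    then have "R * (l * F^2) * F = (E * F)^3" by algebra
    then have "(27 * A4^3) * (R * F) = (27 * A4^3) * (- 27 * A2^3)" unfolding E l by algebra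
    moreover have "27 * A4^3 \<noteq> 0" using A4 by simp
    ultimately have R: "R * F = - 27 * A2^3" using mult_left_cancel by blast
    \<comment> \<open>Multiplied by \<open>R\<close> these are the two cubics in \<open>E\<close>
      and \<open>R\<close>, because \<open>l R = E^3\<close>.\<close>
    define D N where "D = 27 - 18*R - 2*l + 15*E^2 + 12*E*R + 2*R^2 - 36*E"
      and "N = 6*E - 6*R - l - 3*E^2 + 3*E*R + R^2"
    have "D * F^2 = 27*F^2 - 18*(R*F)*F - 2*(l*F^2) + 15*(E*F)^2 + 12*(E*F)*(R*F) + 2*(R*F)^2
      - 36*(E*F)*F" unfolding D_def by algebra
    also have "\<dots> = 1728*dc^2*n^3" unfolding E R l ids(5)[symmetric] by algebra
    finally have D: "D * F^2 = 1728*dc^2*n^3" .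
    have "N * F^2 = 6*(E*F)*F - 6*(R*F)*F - l*F^2 - 3*(E*F)^2 + 3*(E*F)*(R*F) + (R*F)^2"
      unfolding N_def by algebra
    also have "\<dots> = t*(1728*dc^2*n^3)" unfolding E R l ids(6)[symmetric] by algebra
    finally have "N * F^2 = t * D * F^2" unfolding D[symmetric] by algebra
    then have "N = t * D" using F by simp
    moreover have "D \<noteq> 0" using D n dc by auto
    ultimately have "t = N / D" by simp
    also have "\<dots> \<in> generated_field z y"
      unfolding N_def D_def R_def l_def E_def inv_L_def by (intro generated_field_intros)
    finally show ?thesis .
  qed
  moreover from this have "v \<in> generated_field z y"
  proof -
    assume t: "t \<in> generated_field z y"
    have "v = z * F / (2 * n)" using zF n by simp
    also have "\<dots> \<in> generated_field z y"
      unfolding F_def n_def par_defs by (intro generated_field_intros t)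
    finally show ?thesis .
  qed
  ultimately show "generated_field (zpar t v) (ypar t v) = generated_field t v"
    using generated_field_subset[of t z y v] unfolding z_def y_def by blast
qed

text \<open>On the curve \<open>z^2 = d n^2/(k f)\<close>, so \<open>z = 1/X\<close> requires
  \<open>f(\<tau>) = X^2 (d/k) n(\<tau>)^2\<close>, which is solvable in power series at each simple
  root of \<open>f\<close>.\<close>

lemma branch_at_infinity:
  assumes x: "poly fpol x = 0"
  shows "\<exists>\<tau> v. hyperelliptic hpol \<tau> v \<and> fls_nth \<tau> 0 = x \<and> zpar \<tau> v = fls_X_inv"
proof -
  have "poly (smult (d/k) (npol^2)) x \<noteq> 0" using npol_nz_at_root[OF x] d_nz k_nz by simp
  then obtain \<tau> where \<tau>: "fls_nth \<tau> 0 = x" "pev fpol \<tau> = fls_X\<^sup>2 * pev (smult (d/k) (npol^2)) \<tau>"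
    using power_series_root[OF x fpol_simple_roots[OF x]] by blast
  have nc: "\<tau> \<notin> range fls_const"
  proof
    assume "\<tau> \<in> range fls_const"
    then have "\<tau> = fls_const x" using \<tau>(1) by auto
    then have "fls_X\<^sup>2 * fls_const (poly (smult (d/k) (npol^2)) x) = 0" using \<tau>(2) x by (simp add: pev_const)
    then show False using \<open>poly (smult (d/k) (npol^2)) x \<noteq> 0\<close> by simp
  qed
  let ?n = "par_n dc \<tau>"
  have n: "?n \<noteq> 0" using pev_eq_0_iff[OF nc, of npol] by (simp add: pev_npol) (simp add: npol_def)
  have f: "par_f dc \<tau> = fls_X\<^sup>2 * (fls_const (d/k) * ?n^2)"
    using \<tau>(2) by (simp add: pev_fpol pev_npol)
  \<comment> \<open>Forced by \<open>z = 1/X\<close>: this is \<open>f/(2 n X)\<close>.\<close>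
  define v where "v = fls_const (d/(2*k)) * ?n * fls_X"
  have c1: "fls_const (d/(2*k)) ^ 2 = fls_const (d/(4*k)) * fls_const (d/k)"
    by (simp add: power2_eq_square field_simps flip: fls_const_power)
  have "v^2 = fls_const (d/(2*k))^2 * ?n^2 * fls_X\<^sup>2" by (simp add: v_def power_mult_distrib)
  also have "\<dots> = pev hpol \<tau>" unfolding c1 by (simp add: hpol_def pev_fpol f)
  finally have "v^2 = pev hpol \<tau>" .
  then have "hyperelliptic hpol \<tau> v"
    by unfold_locales (simp_all add: degree_hpol rsquarefree_hpol nc)
  moreover have "zpar \<tau> v = fls_X_inv"
  proof -
    have c2: "2 * fls_const (d/(2*k)) = fls_const (d/k)"
      by (simp flip: fls_const_numeral)
    have "2 * ?n * v = fls_const (d/k) * ?n^2 * fls_X"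
      by (simp add: v_def power2_eq_square flip: c2)
    then show ?thesis unfolding zpar_def f using n d_nz k_nz
      by (simp add: power2_eq_square field_simps flip: fls_inverse_X)
  qed
  ultimately show ?thesis using \<tau>(1) by blast
qed

end


section \<open>Generic points, irreducibility and the genus\<close>

lemma generic_points_same_relations:
  "generic_point g a b \<Longrightarrow> generic_point g a' b' \<Longrightarrow> same_relations a b a' b'"
  by (simp add: generic_point_def same_relations_def)

text \<open>Evaluation at the point has values in a field, so its kernel, which \<open>g\<close>
  generates, is a prime ideal.\<close>

lemma irreducible_generic_point:
  assumes "generic_point g a b" "g \<noteq> 0"
  shows "irreducible g"
proof (rule irreducibleI)
  show "\<not> g dvd 1" using assms(1) unfolding generic_point_def by (metis bieval_1 zero_neq_one)
  fix x y assume g: "g = x * y"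
  have "bieval g a b = 0" using assms(1) by (simp add: generic_point_def)
  then have "bieval x a b = 0 \<or> bieval y a b = 0" by (simp add: g)
  then have "g dvd x \<or> g dvd y" using assms(1) by (simp add: generic_point_def)
  then show "x dvd 1 \<or> y dvd 1"
    using assms(2) unfolding g by (metis dvd_mult_cancel_left dvd_mult_cancel_right mult.right_neutral mult_1 mult_eq_0_iff)
qed fact

context curve_parameters
begin

lemma field_hom_par:
  assumes "gen_field_hom t v (generated_field t v) \<phi>"
  shows "\<phi> (zpar t v) = zpar (\<phi> t) (\<phi> v)" "\<phi> (ypar t v) = ypar (\<phi> t) (\<phi> v)"
proof -
  interpret gen_field_hom t v "generated_field t v" \<phi> by fact
  show "\<phi> (zpar t v) = zpar (\<phi> t) (\<phi> v)"
    unfolding zpar_def par_defs by (simp add: phi_simps F_intros)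
  show "\<phi> (ypar t v) = ypar (\<phi> t) (\<phi> v)"
    unfolding ypar_def par_defs by (simp add: phi_simps F_intros)
qed

text \<open>The function \<open>z\<close> has degree 6: a polynomial of smaller degree in \<open>y\<close> vanishing on the curve
  would have six distinct roots, the \<open>y\<close>-coordinates of the branches with \<open>z = 1/t\<close>.\<close>

lemma low_degree_relation:
  assumes hyp: "hyperelliptic hpol t v" and h: "bieval h (zpar t v) (ypar t v) = 0" and deg: "degree h < 6"
  shows "h = 0"
proof -
  let ?R = "{x. poly fpol x = 0}"
  have "\<forall>x. \<exists>\<tau> v. x \<in> ?R \<longrightarrow> hyperelliptic hpol \<tau> v \<and> fls_nth \<tau> 0 = x \<and> zpar \<tau> v = fls_X_inv"
    using branch_at_infinity by blast
  then obtain \<tau> w where br: "\<And>x. x \<in> ?R \<Longrightarrow> hyperelliptic hpol (\<tau> x) (w x)"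
    "\<And>x. x \<in> ?R \<Longrightarrow> fls_nth (\<tau> x) 0 = x" "\<And>x. x \<in> ?R \<Longrightarrow> zpar (\<tau> x) (w x) = fls_X_inv"
    unfolding choice_iff by blast
  have "t \<in> generated_field (zpar t v) (ypar t v)"
    unfolding generated_field_par[OF hyp] by (rule generated_field_gen1)
  then obtain r s where rs: "bieval s (zpar t v) (ypar t v) \<noteq> 0"
    "t = bieval r (zpar t v) (ypar t v) / bieval s (zpar t v) (ypar t v)"
    by (rule generated_fieldE)
  have z_F: "zpar t v \<in> generated_field t v" and y_F: "ypar t v \<in> generated_field t v"
    using generated_field_gen1 generated_field_gen2 unfolding generated_field_par[OF hyp, symmetric]
    by blast+
  let ?y = "\<lambda>x. ypar (\<tau> x) (w x)"
  have branch: "bieval h fls_X_inv (?y x) = 0"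
    "\<tau> x = bieval r fls_X_inv (?y x) / bieval s fls_X_inv (?y x)" if x: "x \<in> ?R" for x
  proof -
    obtain \<phi> where phi: "field_hom (generated_field t v) \<phi>" "\<phi> t = \<tau> x" "\<phi> v = w x"
      using field_hom_exists[OF hyperelliptic_same_relations[OF hyp br(1)[OF x]]] by blast
    interpret gen_field_hom t v "generated_field t v" \<phi> by standard (use phi in auto)
    have zy: "\<phi> (zpar t v) = fls_X_inv" "\<phi> (ypar t v) = ?y x"
      by (simp_all add: field_hom_par[OF gen_field_hom_axioms] phi br(3)[OF x])
    have b: "\<phi> (bieval g (zpar t v) (ypar t v)) = bieval g fls_X_inv (?y x)"
      "bieval g (zpar t v) (ypar t v) \<in> generated_field t v" for g
      using generated_field_bieval[of g "zpar t v" "ypar t v"] generated_field_par[OF hyp]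
      by (simp_all add: phi_bieval z_F y_F zy)
    show "bieval h fls_X_inv (?y x) = 0" using h b(1)[of h] by simp
    have "\<phi> t = bieval r fls_X_inv (?y x) / bieval s fls_X_inv (?y x)"
      by (subst rs(2)) (simp only: phi_divide b)
    then show "\<tau> x = bieval r fls_X_inv (?y x) / bieval s fls_X_inv (?y x)" by (simp add: phi)
  qed
  \<comment> \<open>All six branches have \<open>z = 1/X\<close> and \<open>t\<close> is a rational
    function of \<open>z\<close> and \<open>y\<close>, so equal \<open>y\<close> would force equal
    \<open>\<tau>\<close>; but their constant terms are the distinct roots of
    \<open>f\<close>.\<close>
  have inj: "inj_on ?y ?R"
  proof (rule inj_onI)
    fix x x' assume x: "x \<in> ?R" "x' \<in> ?R" and eq: "?y x = ?y x'"
    have "\<tau> x = \<tau> x'" by (subst (1 2) branch(2)) (use x eq in simp_all)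
    then show "x = x'" using br(2) x by metis
  qed
  \<comment> \<open>At \<open>z = 1/X\<close> the relation becomes a polynomial in \<open>y\<close>
    over the Laurent series with more roots than its degree, hence zero. Since \<open>1/X\<close> is
    transcendental, the coefficients of \<open>h\<close> vanish before the substitution too.\<close>
  let ?h = "map_poly (\<lambda>c. pev c fls_X_inv) h"
  have "?y ` ?R \<subseteq> {b. poly ?h b = 0}"
    using branch(1) by (auto simp: bieval_conv_ev bi.ev_def)
  moreover have "card (?y ` ?R) = 6"
    using card_image[OF inj] card_roots_rsquarefree[OF rsquarefree_fpol] degree_fpol by simp
  moreover have "degree ?h < 6"
  proof -
    have "degree ?h \<le> degree h" by (rule degree_le) (simp add: coeff_map_poly coeff_eq_0)
    then show ?thesis using deg by simp
  qed
  ultimately have "?h = 0"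
    using card_mono[OF poly_roots_finite[of ?h], of "?y ` ?R"] card_poly_roots_bound[of ?h]
    by fastforce
  moreover have "fls_X_inv \<notin> range (fls_const :: complex \<Rightarrow> _)"
    by (metis fls_X_inv_subdegree fls_const_subdegree imageE neg_equal_0_iff_equal zero_neq_one)
  moreover have "pev (coeff h j) fls_X_inv = coeff ?h j" for j by (simp add: coeff_map_poly)
  ultimately have "coeff h j = 0" for j by (simp add: pev_eq_0_iff)
  then show "h = 0" by (simp add: poly_eq_iff)
qed

lemma generic_point_par:
  assumes hyp: "hyperelliptic hpol t v"
    and g: "degree g = 6" "lead_coeff g = 1" "\<And>a b. bieval g a b = inv_g kc (fls_const r) a b"
  shows "generic_point g (zpar t v) (ypar t v)"
  unfolding generic_point_def
proof (intro allI iffI)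
  have g0: "bieval g (zpar t v) (ypar t v) = 0" by (simp add: g(3) curve_par[OF hyp])
  fix h
  show "bieval h (zpar t v) (ypar t v) = 0" if "g dvd h" using that g0 by auto
  assume h: "bieval h (zpar t v) (ypar t v) = 0"
  have "g \<noteq> 0" using g(1) by auto
  \<comment> \<open>Pseudo-division scales \<open>h\<close> by a power of the leading coefficient of
    \<open>g\<close>, which is 1; so this is a true division with remainder.\<close>
  obtain e s where es: "pseudo_divmod h g = (e, s)" by fastforce
  have "h = g * e + s" using pseudo_divmod(1)[OF \<open>g \<noteq> 0\<close> es] g(2) by simp
  moreover have "s = 0"
  proof -
    have "bieval s (zpar t v) (ypar t v) = 0" using h g0 unfolding \<open>h = g * e + s\<close> by simp
    moreover have "s = 0 \<or> degree s < 6" using pseudo_divmod(2)[OF \<open>g \<noteq> 0\<close> es] g(1) by simp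
    ultimately show ?thesis using low_degree_relation[OF hyp] by blast
  qed
  ultimately show "g dvd h" by simp
qed

text \<open>\<open>geometric_genus\<close> evaluates an unknown generic point \<open>(a, b)\<close>.
  The isomorphism of fields carries \<open>t\<close> and \<open>v\<close> to series that satisfy the
  same hyperelliptic equation and generate the field of \<open>(a, b)\<close>, so the genus
  computation applies to it.\<close>

lemma generated_field_genus:
  assumes hyp: "hyperelliptic hpol t v"
    and gen: "generic_point g (zpar t v) (ypar t v)" "generic_point g a b"
  shows "function_field_genus (generated_field a b) = 2"
proof -
  interpret hyperelliptic hpol t v by fact
  obtain \<phi> where phi: "field_hom F \<phi>" "\<phi> (zpar t v) = a" "\<phi> (ypar t v) = b"
    using field_hom_exists[OF generic_points_same_relations[OF gen]]
    unfolding generated_field_par[OF hyp] by blast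
  interpret gen_field_hom t v F \<phi> by standard (use phi in auto)
  have "\<phi> t \<notin> range fls_const"
  proof
    assume "\<phi> t \<in> range fls_const"
    then obtain c where "\<phi> t = fls_const c" by blast
    then have "\<phi> (t - fls_const c) = 0" by (simp add: phi_diff F_intros)
    then have "t - fls_const c = 0" by (subst (asm) phi_eq_0_iff) (simp_all add: F_intros)
    then show False using nonconst by auto
  qed
  moreover have "(\<phi> v)\<^sup>2 = pev hpol (\<phi> t)"
    using arg_cong[OF curve, of \<phi>] by (simp add: phi_simps F_intros)
  ultimately have hyp': "hyperelliptic hpol (\<phi> t) (\<phi> v)"
    by (rule hyperelliptic_branch(1))
  have "a = zpar (\<phi> t) (\<phi> v)" "b = ypar (\<phi> t) (\<phi> v)"
    using field_hom_par[OF gen_field_hom_axioms] phi by auto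
  then have "generated_field a b = generated_field (\<phi> t) (\<phi> v)"
    using generated_field_par[OF hyp'] by simp
  then show ?thesis using hyperelliptic.function_field_genus_eq_2[OF hyp'] by simp
qed

lemma irreducible_genus:
  assumes g: "degree g = 6" "lead_coeff g = 1" "\<And>a b. bieval g a b = inv_g kc (fls_const r) a b"
  shows "irreducible g" "geometric_genus g = 2"
proof -
  have "card {x. poly fpol x = 0} = 6" using card_roots_rsquarefree[OF rsquarefree_fpol] degree_fpol by simp
  then have "{x. poly fpol x = 0} \<noteq> {}" by (metis card.empty zero_neq_numeral)
  then obtain t v where hyp: "hyperelliptic hpol t v" using branch_at_infinity by blast
  note gen = generic_point_par[OF hyp g]
  show "irreducible g" using g(1) by (intro irreducible_generic_point[OF gen]) auto
  let ?P = "\<lambda>(a, b). generic_point g a b"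
  have "?P (zpar t v, ypar t v)" using gen by simp
  then have "?P (SOME ab. ?P ab)" by (rule someI)
  then show "geometric_genus g = 2"
    unfolding geometric_genus_def using generated_field_genus[OF hyp gen]
    by (auto simp: Let_def split: prod.splits)
qed

end

theorem corollary5:
  fixes p q :: real
  assumes "q \<noteq> 0"
  shows "quadratic_system sysP (sysQ q) \<and>
    invariant_curve sysP (sysQ q) (curve_g p q) (18 * Y) \<and>
    total_degree (curve_g p q) = 18 \<and>
    (169 * p \<noteq> 192 * q^2 \<and> 169 * p \<noteq> - 240 * q^2 \<longrightarrow>
      irreducible (complexify (curve_g p q)) \<and> geometric_genus (complexify (curve_g p q)) = 2)"
proof (intro conjI impI)
  assume *: "169 * p \<noteq> 192 * q^2 \<and> 169 * p \<noteq> - 240 * q^2"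
  define k r where "k = q / 13" and "r = p / 64"
  have q: "q = 13 * k" and p: "p = 64 * r" by (simp_all add: k_def r_def)
  have k: "k \<noteq> 0" using assms by (simp add: k_def)
  \<comment> \<open>The two excluded equations become \<open>r = 3 k^2\<close> and
    \<open>15 k^2 + 4 r = 0\<close>; the second expression is, up to sign, the numerator of
    \<open>d\<close>.\<close>
  have n1: "3*k^2 - r \<noteq> 0" and n2: "15*k^2 + 4*r \<noteq> 0"
    using * unfolding p q by (auto simp: power_mult_distrib)
  define d where "d = 4 - 27*k^2 / (3*k^2 - r)"
  have "d = - (15*k^2 + 4*r) / (3*k^2 - r)" using n1 by (simp add: d_def field_simps)
  then have d: "d \<noteq> 0" using n1 n2 by auto
  have d4: "d \<noteq> 4" using n1 k by (simp add: d_def)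
  have eq: "(3*k^2 - r) * (4 - d) = 27*k^2" using n1 by (simp add: d_def)
  interpret curve_parameters "complex_of_real k" "complex_of_real d" "complex_of_real r"
  proof
    show "(3 * (complex_of_real k)\<^sup>2 - complex_of_real r) * (4 - complex_of_real d) = 27 * (complex_of_real k)\<^sup>2"
      using arg_cong[OF eq, of complex_of_real] by simp
    show "complex_of_real d \<noteq> 4" using d4 by (metis of_real_eq_iff of_real_numeral)
  qed (use k d in auto)
  note g = irreducible_genus[OF curve_g_monic bieval_curve_g[of p q, folded k_def r_def]]
  show "irreducible (complexify (curve_g p q))" "geometric_genus (complexify (curve_g p q)) = 2"
    by (rule g)+
qed (use quadratic_system invariant_curve_curve_g total_degree_curve_g[OF assms] in auto)

end
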